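(* Let $\mathcal{H}$ be a real Hilbert space, let $n\geq 2$ and $L>0$, let $A_1,\dots,A_n\colon\mathcal{H}\rightrightarrows\mathcal{H}$ be maximally monotone and let $B_1,\dots,B_{n-1}\colon\mathcal{H}\to\mathcal{H}$ be $\frac{1}{L}$-cocoercive with $\operatorname{zer}\left(\sum_{i=1}^nA_i+\sum_{i=1}^{n-1}B_i\right)\neq\varnothing$. Further, let $\lambda\in\bigl(0,\frac{2}{L}\bigr)$ and $\gamma\in\bigl(0,1-\frac{\lambda L}{2}\bigr)$. Given $\mathbf{z}^0=(z_1^0,\dots,z_{n-1}^0)\in\mathcal{H}^{n-1}$, let $(\mathbf{z}^k)_{k\ge 0}\subseteq\mathcal{H}^{n-1}$ and $(\mathbf{x}^k)_{k\ge 0}\subseteq\mathcal{H}^n$, with $\mathbf{z}^k=(z_1^k,\dots,z_{n-1}^k)$ and $\mathbf{x}^k=(x_1^k,\dots,x_n^k)$, be the sequences given for all $k\geq 0$ by $$\begin{cases} x_1^k=J_{\lambda A_1}(z_1^k),\\ x_i^k=J_{\lambda A_i}\bigl(z_i^k+x_{i-1}^k-z_{i-1}^k-\lambda B_{i-1}(x_{i-1}^k)\bigr)\quad \forall i\in\{2,\dots,n-1\},\\ x_n^k=J_{\lambda A_n}\bigl(x_1^k+x_{n-1}^k-z_{n-1}^k-\lambda B_{n-1}(x_{n-1}^k)\bigr), \end{cases}$$ and $$\mathbf{z}^{k+1}=\mathbf{z}^k+\gamma\,\bigl(x_2^k-x_1^k,\;x_3^k-x_2^k,\;\dots,\;x_n^k-x_{n-1}^k\bigr).$$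 Then the following assertions hold. (a) The sequence $(\mathbf{z}^k)$ converges weakly to a point $\mathbf{z}\in\operatorname{Fix} T$, where $T$ is the operator defined in the context. (b) The sequence $(\mathbf{x}^k)$ converges weakly to a point $(x,\dots,x)\in\mathcal{H}^n$ with $x\in\operatorname{zer}\left(\sum_{i=1}^nA_i+\sum_{i=1}^{n-1}B_i\right)$. (c) With $x$ as in (b), the sequence $\bigl(B_i(x_i^k)\bigr)_k$ converges strongly to $B_i(x)$ for all $i\in\{1,\dots,n-1\}$.
   Context: $\mathcal{H}$ is a real Hilbert space with inner product $\langle\cdot,\cdot\rangle$ and induced norm $\|\cdot\|$; products $\mathcal{H}^m$ carry the usual product Hilbert space structure, $\|\mathbf{z}\|^2=\sum_i\|z_i\|^2$. A set-valued operator $A\colon\mathcal{H}\rightrightarrows\mathcal{H}$ assigns to each $x\in\mathcal H$ a subset $A(x)\subseteq\mathcal{H}$; it is monotone if $\langle x-y,u-v\rangle\geq 0$ whenever $u\in A(x)$, $v\in A(y)$, and maximally monotone if no monotone operator has a graph properly containing its graph. $\operatorname{zer}A=\{x: 0\in A(x)\}$ and $\operatorname{Fix}A=\{x: x\in A(x)\}$ (so $\operatorname{Fix} T=\{\mathbf{z}:T(\mathbf{z})=\mathbf{z}\}$ for single-valued $T$). An operator $B\colon\mathcal{H}\to\mathcal{H}$ is $\frac1L$-cocoercive ($L>0$) if $\langle B(x)-B(y),x-y\rangle\geq\frac1L\|B(x)-B(y)\|^2$ for all $x,y\in\mathcal{H}$. The resolvent of $A$ with parameter $\lambda>0$ is $J_{\lambda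 A}=(\operatorname{Id}+\lambda A)^{-1}$, which is single-valued with full domain when $A$ is maximally monotone. The operator $T\colon\mathcal{H}^{n-1}\to\mathcal{H}^{n-1}$ is defined by $T(\mathbf{z}):=\mathbf{z}+\gamma\,(x_2-x_1,\;x_3-x_2,\;\dots,\;x_n-x_{n-1})$, where $\mathbf{x}=(x_1,\dots,x_n)\in\mathcal{H}^n$ depends on $\mathbf{z}=(z_1,\dots,z_{n-1})$ via $x_1=J_{\lambda A_1}(z_1)$; $x_i=J_{\lambda A_i}(z_i+x_{i-1}-z_{i-1}-\lambda B_{i-1}(x_{i-1}))$ for $i\in\{2,\dots,n-1\}$; and $x_n=J_{\lambda A_n}(x_1+x_{n-1}-z_{n-1}-\lambda B_{n-1}(x_{n-1}))$. Thus $\mathbf{z}^{k+1}=T(\mathbf{z}^k)$. When $n=2$ the index set $\{2,\dots,n-1\}$ is empty. *)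

theory Defs
  imports "HOL-Analysis.Analysis" "HOL-Library.Set_Algebras"
begin

text \<open>Set-valued operators on a real Hilbert space are functions into sets; sums of operators are
  pointwise Minkowski sums (instances from Set_Algebras), with a single-valued \<open>B\<close> read
  as \<open>\<lambda>x. {B x}\<close>.\<close>

definition op_graph :: "('a \<Rightarrow> 'b set) \<Rightarrow> ('a \<times> 'b) set" where
  "op_graph A = {(x, u). u \<in> A x}"

definition op_inverse :: "('a \<Rightarrow> 'b set) \<Rightarrow> 'b \<Rightarrow> 'a set" where
  "op_inverse A = (\<lambda>u. {x. u \<in> A x})"

definition zer :: "('a \<Rightarrow> 'b::zero set) \<Rightarrow> 'a set" where
  "zer A = {x. 0 \<in> A x}"

definition monotone_op :: "('a::real_inner \<Rightarrow> 'a set) \<Rightarrow> bool" where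
  "monotone_op A \<longleftrightarrow> (\<forall>x y u v. u \<in> A x \<longrightarrow> v \<in> A y \<longrightarrow> (x - y) \<bullet> (u - v) \<ge> 0)"

definition maximally_monotone :: "('a::real_inner \<Rightarrow> 'a set) \<Rightarrow> bool" where
  "maximally_monotone A \<longleftrightarrow>
     monotone_op A \<and> \<not> (\<exists>A'. monotone_op A' \<and> op_graph A \<subset> op_graph A')"

definition cocoercive :: "real \<Rightarrow> ('a::real_inner \<Rightarrow> 'a) \<Rightarrow> bool" where
  "cocoercive \<beta> B \<longleftrightarrow> (\<forall>x y. (B x - B y) \<bullet> (x - y) \<ge> \<beta> * (norm (B x - B y))\<^sup>2)"

text \<open>The definite description is meaningful for maximally monotone \<open>A\<close> and \<open>lam > 0\<close> on a
  Hilbert space, where \<open>(Id + lam A)\<^sup>-\<^sup>1\<close> is single-valued with full domain (Minty).\<close>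

definition resolvent :: "real \<Rightarrow> ('a::real_inner \<Rightarrow> 'a set) \<Rightarrow> 'a \<Rightarrow> 'a" where
  "resolvent lam A y = (THE x. x \<in> op_inverse (\<lambda>x. {x} + (\<lambda>u. lam *\<^sub>R u) ` A x) y)"

text \<open>The power \<open>H\<^sup>m\<close> consists of the functions on the indices \<open>1, ..., m\<close>, extended by
  \<open>undefined\<close>, so that equality of functions is equality of tuples.\<close>

definition hpow :: "nat \<Rightarrow> (nat \<Rightarrow> 'a) set" where
  "hpow m = extensional {1..m}"

definition hinner :: "nat \<Rightarrow> (nat \<Rightarrow> 'a::real_inner) \<Rightarrow> (nat \<Rightarrow> 'a) \<Rightarrow> real" where
  "hinner m v w = (\<Sum>i=1..m. v i \<bullet> w i)"

text \<open>Weak convergence in the product Hilbert space \<open>H\<^sup>m\<close>; by the Riesz representation its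
  continuous linear functionals are the inner products with its elements.\<close>

definition weakly_converges ::
  "nat \<Rightarrow> (nat \<Rightarrow> nat \<Rightarrow> 'a::real_inner) \<Rightarrow> (nat \<Rightarrow> 'a) \<Rightarrow> bool" where
  "weakly_converges m v w \<longleftrightarrow>
     (\<forall>u\<in>hpow m. (\<lambda>k. hinner m (v k) u) \<longlonglongrightarrow> hinner m w u)"

text \<open>\<open>sweep n lam A B z i\<close> is the \<open>i\<close>-th component of \<open>\<^bold>x = (x\<^sub>1, ..., x\<^sub>n)\<close> as a function of
  \<open>\<^bold>z\<close>; only indices in \<open>{1..n}\<close> matter.\<close>

fun sweep :: "nat \<Rightarrow> real \<Rightarrow> (nat \<Rightarrow> 'a::real_inner \<Rightarrow> 'a set) \<Rightarrow> (nat \<Rightarrow> 'a \<Rightarrow> 'a)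
    \<Rightarrow> (nat \<Rightarrow> 'a) \<Rightarrow> nat \<Rightarrow> 'a" where
  "sweep n lam A B z 0 = undefined"
| "sweep n lam A B z (Suc 0) = resolvent lam (A 1) (z 1)"
| "sweep n lam A B z (Suc (Suc j)) =
     resolvent lam (A (j + 2))
       ((if j + 2 < n then z (j + 2) else sweep n lam A B z 1)
        + sweep n lam A B z (j + 1) - z (j + 1)
        - lam *\<^sub>R B (j + 1) (sweep n lam A B z (j + 1)))"

lemma sweep_1: "sweep n lam A B z 1 = resolvent lam (A 1) (z 1)"
  by simp

lemma sweep_middle:
  assumes "i \<in> {2..n - 1}"
  shows "sweep n lam A B z i = resolvent lam (A i)
    (z i + sweep n lam A B z (i - 1) - z (i - 1)
     - lam *\<^sub>R B (i - 1) (sweep n lam A B z (i - 1)))"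
proof -
  obtain j where "i = Suc (Suc j)"
    using assms by (metis add_2_eq_Suc atLeastAtMost_iff le_Suc_ex)
  then show ?thesis
    using assms by auto
qed

lemma sweep_last:
  assumes "n \<ge> 2"
  shows "sweep n lam A B z n = resolvent lam (A n)
    (sweep n lam A B z 1 + sweep n lam A B z (n - 1) - z (n - 1)
     - lam *\<^sub>R B (n - 1) (sweep n lam A B z (n - 1)))"
proof -
  obtain j where "n = Suc (Suc j)"
    using assms by (metis add_2_eq_Suc le_Suc_ex)
  then show ?thesis
    by auto
qed

definition T_op :: "nat \<Rightarrow> real \<Rightarrow> real \<Rightarrow> (nat \<Rightarrow> 'a::real_inner \<Rightarrow> 'a set) \<Rightarrow> (nat \<Rightarrow> 'a \<Rightarrow> 'a)
    \<Rightarrow> (nat \<Rightarrow> 'a) \<Rightarrow> (nat \<Rightarrow> 'a)" where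
  "T_op n lam \<gamma> A B z =
     (\<lambda>i\<in>{1..n - 1}. z i + \<gamma> *\<^sub>R (sweep n lam A B z (i + 1) - sweep n lam A B z i))"

definition Fix_on :: "'b set \<Rightarrow> ('b \<Rightarrow> 'b) \<Rightarrow> 'b set" where
  "Fix_on X T = {z \<in> X. T z = z}"

end

theory Submission
  imports Defs
begin

text \<open>Every zero \<open>p\<close> of the sum lifts to a fixed point \<open>w\<close> of \<open>T\<close>. Monotonicity of the \<open>A i\<close> at the
  iterates and at \<open>p\<close>, summed around the ring, together with Young's inequality and cocoercivity
  shows that \<open>\<parallel>z\<^sup>k - w\<parallel>\<^sup>2\<close> decreases by at least a positive multiple of
  \<open>\<Sum>\<parallel>x\<^sub>i\<^sub>+\<^sub>1 - x\<^sub>i\<parallel>\<^sup>2 + \<Sum>\<parallel>B\<^sub>i x\<^sub>i - B\<^sub>i p\<parallel>\<^sup>2\<close>. So both sums tend to \<open>0\<close>, which gives (c). Weak cluster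
  points of \<open>(z\<^sup>k, x\<^sub>1\<^sup>k)\<close> are again a fixed point and its zero, since the sum of the resolvent
  inclusions pairs a strongly with a weakly convergent sequence; Opial's argument makes the cluster
  point unique. Cluster points are taken along filters finer than \<open>sequentially\<close>, so that weak
  compactness reduces to Tychonoff's theorem and no separability is needed.\<close>

section \<open>Riesz representation and Minty's theorem\<close>

text \<open>The supremum of the \<open>g i\<close> plus half the squared norm is handled through its
  upper bounds \<open>t\<close>, so it may be infinite. Midpoint convexity and the parallelogram law
  make a minimising sequence Cauchy. A single \<open>g\<close> serves for Riesz, a family indexed by
  a monotone graph for Minty.\<close>

lemma min_strongly_convex:
  fixes g :: "'i \<Rightarrow> 'a::{real_inner,complete_space} \<Rightarrow> real"
  assumes cont: "\<And>i. i \<in> I \<Longrightarrow> continuous_on UNIV (g i)"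
    and mid: "\<And>i p q. i \<in> I \<Longrightarrow> g i ((1/2) *\<^sub>R (p + q)) \<le> (g i p + g i q) / 2"
    and feas: "\<And>i. i \<in> I \<Longrightarrow> g i p0 + (norm p0)\<^sup>2 / 2 \<le> t0"
    and lower: "\<And>p t. (\<And>i. i \<in> I \<Longrightarrow> g i p + (norm p)\<^sup>2 / 2 \<le> t) \<Longrightarrow> c \<le> t"
  obtains p m where "\<And>i. i \<in> I \<Longrightarrow> g i p + (norm p)\<^sup>2 / 2 \<le> m"
    and "\<And>q t. (\<And>i. i \<in> I \<Longrightarrow> g i q + (norm q)\<^sup>2 / 2 \<le> t) \<Longrightarrow> m \<le> t"
proof -
  define V where "V = {t. \<exists>p. \<forall>i\<in>I. g i p + (norm p)\<^sup>2 / 2 \<le> t}"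
  define m where "m = Inf V"
  have ne: "V \<noteq> {}" using feas unfolding V_def by blast
  have bb: "bdd_below V" using lower unfolding V_def bdd_below_def by blast
  have m_le: "m \<le> t" if "\<And>i. i \<in> I \<Longrightarrow> g i q + (norm q)\<^sup>2 / 2 \<le> t" for q t
    unfolding m_def using that bb by (intro cInf_lower) (auto simp: V_def)
  have "\<exists>p. \<forall>i\<in>I. g i p + (norm p)\<^sup>2 / 2 \<le> m + 1 / real (Suc k)" for k
  proof -
    have "Inf V < m + 1 / real (Suc k)" unfolding m_def by simp
    then obtain t where "t \<in> V" "t < m + 1 / real (Suc k)"
      using cInf_lessD[OF ne] by blast
    then obtain p where "\<forall>i\<in>I. g i p + (norm p)\<^sup>2 / 2 \<le> t" unfolding V_def by blast
    with \<open>t < _\<close> show ?thesis by (meson less_imp_le order_trans)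
  qed
  then obtain P where P: "\<And>k i. i \<in> I \<Longrightarrow> g i (P k) + (norm (P k))\<^sup>2 / 2 \<le> m + 1 / real (Suc k)"
    by metis
  have dist_bound: "(norm (P k - P l))\<^sup>2 \<le> 4 * (1 / real (Suc k) + 1 / real (Suc l))" for k l
  proof -
    have n2: "(norm ((1/2) *\<^sub>R (P k + P l)))\<^sup>2
       = (norm (P k))\<^sup>2 / 2 + (norm (P l))\<^sup>2 / 2 - (norm (P k - P l))\<^sup>2 / 4"
      by (simp add: power2_norm_eq_inner inner_add inner_diff inner_commute field_simps)
    \<comment> \<open>The midpoint of \<open>P k\<close> and \<open>P l\<close> is admissible for a
      value lowered by an eighth of their squared distance, and it cannot undercut the
      infimum.\<close>
    have "m \<le> m + (1 / real (Suc k) + 1 / real (Suc l)) / 2 - (norm (P k - P l))\<^sup>2 / 8"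
    proof (rule m_le)
      fix i assume i: "i \<in> I"
      show "g i ((1/2) *\<^sub>R (P k + P l)) + (norm ((1/2) *\<^sub>R (P k + P l)))\<^sup>2 / 2
          \<le> m + (1 / real (Suc k) + 1 / real (Suc l)) / 2 - (norm (P k - P l))\<^sup>2 / 8"
        unfolding n2 using mid[OF i, of "P k" "P l"] P[OF i, of k] P[OF i, of l]
        by argo
    qed
    then show ?thesis by simp
  qed
  have "Cauchy P"
  proof (rule metric_CauchyI)
    fix e :: real assume "e > 0"
    then have "e\<^sup>2 / 8 > 0" by simp
    then obtain M where M: "1 / real (Suc M) < e\<^sup>2 / 8" using nat_approx_posE by blast
    have "dist (P k) (P l) < e" if "k \<ge> M" "l \<ge> M" for k l
    proof -
      have "1 / real (Suc k) \<le> 1 / real (Suc M)" "1 / real (Suc l) \<le> 1 / real (Suc M)"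
        using that by (simp_all add: field_simps)
      then have "(norm (P k - P l))\<^sup>2 < e\<^sup>2" using dist_bound[of k l] M by argo
      then show ?thesis using \<open>e > 0\<close> by (simp add: dist_norm power_less_imp_less_base)
    qed
    then show "\<exists>M. \<forall>m\<ge>M. \<forall>n\<ge>M. dist (P m) (P n) < e" by blast
  qed
  then obtain p where p: "P \<longlonglongrightarrow> p" using Cauchy_convergent convergent_def by blast
  have "g i p + (norm p)\<^sup>2 / 2 \<le> m" if i: "i \<in> I" for i
  proof (rule LIMSEQ_le)
    have "(\<lambda>k. g i (P k)) \<longlonglongrightarrow> g i p"
      using cont[OF i] p by (simp add: continuous_on_eq_continuous_at isCont_tendsto_compose)
    then show "(\<lambda>k. g i (P k) + (norm (P k))\<^sup>2 / 2) \<longlonglongrightarrow> g i p + (norm p)\<^sup>2 / 2"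
      by (intro tendsto_intros p) auto
    show "(\<lambda>k. m + 1 / real (Suc k)) \<longlonglongrightarrow> m"
      using LIMSEQ_inverse_real_of_nat_add[of m] by (simp add: inverse_eq_divide)
    show "\<exists>N. \<forall>k\<ge>N. g i (P k) + (norm (P k))\<^sup>2 / 2 \<le> m + 1 / real (Suc k)"
      using P[OF i] by blast
  qed
  then show thesis using that m_le by blast
qed

text \<open>First-order conditions are read off from an inequality that holds for all small \<open>t > 0\<close>.\<close>

lemma nonneg_of_small_multiples:
  fixes a b :: real
  assumes "\<And>t. 0 < t \<Longrightarrow> t \<le> 1 \<Longrightarrow> 0 \<le> t * a + t\<^sup>2 * b"
  shows "0 \<le> a"
proof -
  have "((\<lambda>t. a + t * b) \<longlongrightarrow> a + 0 * b) (at_right 0)" by (intro tendsto_intros)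
  moreover have "eventually (\<lambda>t. 0 \<le> a + t * b) (at_right 0)"
  proof -
    have "eventually (\<lambda>t::real. 0 < t \<and> t < 1) (at_right 0)"
      by (auto intro: eventually_conj eventually_at_right_less eventually_at_rightI[of 0 1])
    then show ?thesis
    proof eventually_elim
      case (elim t)
      then have "0 \<le> t * (a + t * b)" using assms[of t] by (simp add: power2_eq_square algebra_simps)
      then show ?case using elim by (simp add: zero_le_mult_iff)
    qed
  qed
  ultimately show ?thesis using tendsto_lowerbound by fastforce
qed

text \<open>The minimiser of \<open>(norm q)\<^sup>2 / 2 - f q\<close> represents \<open>f\<close>,
  because the derivative there vanishes in every direction.\<close>

lemma riesz_representation:
  fixes f :: "'a::{real_inner,complete_space} \<Rightarrow> real"
  assumes "bounded_linear f"
  obtains r where "\<And>u. f u = r \<bullet> u"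
proof -
  interpret bounded_linear f by fact
  obtain K where K: "\<And>x. norm (f x) \<le> norm x * K" using bounded by blast
  obtain p m where p: "\<And>i. i \<in> UNIV \<Longrightarrow> - f p + (norm p)\<^sup>2 / 2 \<le> m"
    and m: "\<And>q t. (\<And>i. i \<in> UNIV \<Longrightarrow> - f q + (norm q)\<^sup>2 / 2 \<le> t) \<Longrightarrow> m \<le> t"
  \<comment> \<open>One index suffices; the lower bound \<open>- K\<^sup>2 / 2\<close> comes from
    completing the square in \<open>(norm p)\<^sup>2 / 2 - norm p * K\<close>.\<close>
  proof (rule min_strongly_convex[of "UNIV :: unit set" "\<lambda>_ q. - f q" 0 0 "- K\<^sup>2 / 2"])
    fix i show "continuous_on UNIV (\<lambda>q. - f q)"
      by (intro continuous_intros linear_continuous_on bounded_linear_axioms)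
  next
    fix p t assume "\<And>i::unit. i \<in> UNIV \<Longrightarrow> - f p + (norm p)\<^sup>2 / 2 \<le> t"
    then have "- f p + (norm p)\<^sup>2 / 2 \<le> t" by blast
    moreover have "f p \<le> norm p * K" using K[of p] by simp
    moreover have "0 \<le> (norm p - K)\<^sup>2" by simp
    ultimately show "- K\<^sup>2 / 2 \<le> t" by (simp add: power2_diff)
  next
    fix p q show "- f ((1/2) *\<^sub>R (p + q)) \<le> (- f p + - f q) / 2"
      by (simp only: scaleR add real_scaleR_def) argo
  next
    show "- f 0 + (norm (0::'a))\<^sup>2 / 2 \<le> 0" by (simp add: zero)
  qed (use that in blast)
  have ge: "f u \<le> p \<bullet> u" for u
  proof -
    have "0 \<le> p \<bullet> u - f u"
    proof (rule nonneg_of_small_multiples[where b = "(norm u)\<^sup>2 / 2"])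
      fix t :: real
      have "- f p + (norm p)\<^sup>2 / 2 \<le> m" using p by blast
      also have "m \<le> - f (p + t *\<^sub>R u) + (norm (p + t *\<^sub>R u))\<^sup>2 / 2"
        by (rule m[of "p + t *\<^sub>R u"]) simp
      finally have *: "- f p + (norm p)\<^sup>2 / 2 \<le> - f (p + t *\<^sub>R u) + (norm (p + t *\<^sub>R u))\<^sup>2 / 2" .
      have "(norm (p + t *\<^sub>R u))\<^sup>2 = (norm p)\<^sup>2 + 2 * t * (p \<bullet> u) + t\<^sup>2 * (norm u)\<^sup>2"
        by (simp only: power2_norm_eq_inner)
           (simp add: inner_add inner_commute power2_eq_square)
      then show "0 \<le> t * (p \<bullet> u - f u) + t\<^sup>2 * ((norm u)\<^sup>2 / 2)"
        using * by (simp add: add scaleR field_simps)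
    qed
    then show ?thesis by simp
  qed
  have "f u = p \<bullet> u" for u
    using ge[of u] ge[of "- u"] by (simp add: neg)
  then show thesis using that by blast
qed

section \<open>Maximal monotonicity, Minty's theorem and resolvents\<close>

lemma maximally_monotone_mono:
  assumes "maximally_monotone A" "u \<in> A x" "v \<in> A y"
  shows "0 \<le> (x - y) \<bullet> (u - v)"
  using assms unfolding maximally_monotone_def monotone_op_def by blast

text \<open>Otherwise the pair could be adjoined to the graph, giving a strictly larger monotone
  operator.\<close>

lemma maximally_monotone_mem:
  assumes "maximally_monotone A"
    and "\<And>a b. b \<in> A a \<Longrightarrow> 0 \<le> (x - a) \<bullet> (u - b)"
  shows "u \<in> A x"
proof (rule ccontr)
  assume nu: "u \<notin> A x"
  define A' where "A' = A(x := insert u (A x))"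
  have mono: "monotone_op A" using assms(1) by (simp add: maximally_monotone_def)
  have "0 \<le> (a - x) \<bullet> (b - u)" if "b \<in> A a" for a b
    using assms(2)[OF that] by (simp add: inner_diff algebra_simps)
  then have "monotone_op A'"
    using mono assms(2) unfolding monotone_op_def A'_def by (auto split: if_splits)
  moreover have "op_graph A \<subset> op_graph A'"
    using nu by (auto simp: op_graph_def A'_def split: if_splits)
  ultimately show False using assms(1) by (auto simp: maximally_monotone_def)
qed

text \<open>Minty's theorem by minimising \<open>F + \<parallel>\<cdot>\<parallel>\<^sup>2/2\<close>, where \<open>F(x, u) = sup (x \<bullet> b + a \<bullet> u - a \<bullet> b)\<close> is
  the Fitzpatrick function; maximality gives \<open>F(x, u) \<ge> x \<bullet> u\<close> with equality on the graph.\<close>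

lemma minty_zero:
  fixes G :: "('a::{real_inner,complete_space} \<times> 'a) set"
  assumes mono: "\<And>x u a b. (x, u) \<in> G \<Longrightarrow> (a, b) \<in> G \<Longrightarrow> 0 \<le> (x - a) \<bullet> (u - b)"
    and max: "\<And>x u. (\<And>a b. (a, b) \<in> G \<Longrightarrow> 0 \<le> (x - a) \<bullet> (u - b)) \<Longrightarrow> (x, u) \<in> G"
  obtains x where "(x, - x) \<in> G"
proof -
  define g where "g = (\<lambda>(a::'a, b::'a) (x::'a, u::'a). x \<bullet> b + a \<bullet> u - a \<bullet> b)"
  have g_diff: "(fst q - fst i) \<bullet> (snd q - snd i) = fst q \<bullet> snd q - g i q" for i q
    by (simp add: g_def split_def inner_diff inner_commute)
  have g_graph: "g i q \<le> fst q \<bullet> snd q" if "i \<in> G" "q \<in> G" for i q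
    using mono[of "fst q" "snd q" "fst i" "snd i"] that g_diff[of q i] by simp
  \<comment> \<open>If \<open>s\<close> were below \<open>fst q \<bullet> snd q\<close>, then
    \<open>q\<close> would be strictly monotonically related to all of \<open>G\<close>. Maximality
    puts \<open>q\<close> itself into \<open>G\<close>, where strictness fails against
    \<open>q\<close>.\<close>
  have F_ge: "fst q \<bullet> snd q \<le> s" if "\<And>i. i \<in> G \<Longrightarrow> g i q \<le> s" for q s
  proof (rule ccontr)
    assume "\<not> fst q \<bullet> snd q \<le> s"
    then have pos: "0 < (fst q - fst i) \<bullet> (snd q - snd i)" if "i \<in> G" for i
      using \<open>\<And>i. i \<in> G \<Longrightarrow> g i q \<le> s\<close>[OF that] g_diff[of q i] by simp
    have "0 \<le> (fst q - a) \<bullet> (snd q - b)" if "(a, b) \<in> G" for a b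
      using pos[OF that] by simp
    then have "(fst q, snd q) \<in> G" by (rule max)
    then show False using pos[of q] by simp
  qed
  \<comment> \<open>An empty \<open>G\<close> would satisfy the premise of \<open>max\<close>
    vacuously and so contain every pair.\<close>
  obtain i0 where i0: "i0 \<in> G" using max by blast
  have aff: "g i ((1 - t) *\<^sub>R p + t *\<^sub>R q) = (1 - t) * g i p + t * g i q" for i p q t
    by (simp add: g_def split_def inner_add inner_commute algebra_simps)
  have norm_sq: "(norm q)\<^sup>2 = (norm (fst q))\<^sup>2 + (norm (snd q))\<^sup>2" for q :: "'a \<times> 'a"
    by (simp add: norm_prod_def)
  obtain P m where P: "\<And>i. i \<in> G \<Longrightarrow> g i P + (norm P)\<^sup>2 / 2 \<le> m"
    and m: "\<And>q t. (\<And>i. i \<in> G \<Longrightarrow> g i q + (norm q)\<^sup>2 / 2 \<le> t) \<Longrightarrow> m \<le> t"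
  \<comment> \<open>The lower bound 0 holds because the estimate from \<open>F_ge\<close> plus
    \<open>(norm p)\<^sup>2 / 2\<close> is the square
    \<open>(norm (fst p + snd p))\<^sup>2 / 2\<close>.\<close>
  proof (rule min_strongly_convex[of G g i0 "fst i0 \<bullet> snd i0 + (norm i0)\<^sup>2 / 2" 0])
    fix i show "continuous_on UNIV (g i)"
      unfolding g_def split_def by (intro continuous_intros)
  next
    fix i p q show "g i ((1/2) *\<^sub>R (p + q)) \<le> (g i p + g i q) / 2"
      using aff[of i "1/2" p q] by (simp add: scaleR_add_right)
  next
    fix i assume "i \<in> G"
    then show "g i i0 + (norm i0)\<^sup>2 / 2 \<le> fst i0 \<bullet> snd i0 + (norm i0)\<^sup>2 / 2"
      using g_graph[OF _ i0] by simp
  next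
    fix p t assume "\<And>i. i \<in> G \<Longrightarrow> g i p + (norm p)\<^sup>2 / 2 \<le> t"
    then have "fst p \<bullet> snd p \<le> t - (norm p)\<^sup>2 / 2" by (intro F_ge) force
    moreover have "0 \<le> (norm (fst p + snd p))\<^sup>2" by simp
    ultimately show "0 \<le> t"
      by (simp add: norm_sq power2_norm_eq_inner inner_add inner_commute add_divide_distrib)
  qed (use that in blast)
  define x0 u0 where "x0 = fst P" and "u0 = snd P"
  have FP: "x0 \<bullet> u0 \<le> m - (norm P)\<^sup>2 / 2"
    unfolding x0_def u0_def using P by (intro F_ge) force
  \<comment> \<open>First-order optimality at \<open>P\<close> in the direction of a graph point,
    where the Fitzpatrick function is at most \<open>a \<bullet> b\<close>; \<open>FP\<close> then
    turns the left side into a square.\<close>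
  have key: "(norm (x0 + u0))\<^sup>2 \<le> (a + u0) \<bullet> (b + x0)" if ab: "(a, b) \<in> G" for a b
  proof -
    define q where "q = (a, b)"
    have "0 \<le> (a \<bullet> b - (m - (norm P)\<^sup>2 / 2) + P \<bullet> (q - P))"
    proof (rule nonneg_of_small_multiples[where b = "(norm (q - P))\<^sup>2 / 2"])
      fix t :: real assume t: "0 < t" "t \<le> 1"
      define R where "R = (1 - t) *\<^sub>R P + t *\<^sub>R q"
      have R: "(norm R)\<^sup>2 = (norm P)\<^sup>2 + 2 * t * (P \<bullet> (q - P)) + t\<^sup>2 * (norm (q - P))\<^sup>2"
      proof -
        have "R = P + t *\<^sub>R (q - P)" by (simp add: R_def algebra_simps)
        then show ?thesis
          by (simp only: power2_norm_eq_inner)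
             (simp add: inner_add inner_commute power2_eq_square)
      qed
      have "m \<le> (1 - t) * (m - (norm P)\<^sup>2 / 2) + t * (a \<bullet> b) + (norm R)\<^sup>2 / 2"
      proof (rule m)
        fix i assume i: "i \<in> G"
        have "(1 - t) * g i P \<le> (1 - t) * (m - (norm P)\<^sup>2 / 2)"
          using t P[OF i] by (intro mult_left_mono) auto
        moreover have "t * g i q \<le> t * (a \<bullet> b)"
          using t g_graph[OF i, of q] ab by (intro mult_left_mono) (auto simp: q_def)
        ultimately show "g i R + (norm R)\<^sup>2 / 2
            \<le> (1 - t) * (m - (norm P)\<^sup>2 / 2) + t * (a \<bullet> b) + (norm R)\<^sup>2 / 2"
          unfolding R_def aff by linarith
      qed
      then show "0 \<le> t * (a \<bullet> b - (m - (norm P)\<^sup>2 / 2) + P \<bullet> (q - P))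
          + t\<^sup>2 * ((norm (q - P))\<^sup>2 / 2)"
        unfolding R by (simp add: field_simps)
    qed
    moreover have "P \<bullet> (q - P) = x0 \<bullet> a + u0 \<bullet> b - (norm x0)\<^sup>2 - (norm u0)\<^sup>2"
      by (simp add: inner_prod_def q_def x0_def u0_def inner_diff power2_norm_eq_inner)
    ultimately have "(norm x0)\<^sup>2 + (norm u0)\<^sup>2 + x0 \<bullet> u0 \<le> a \<bullet> b + x0 \<bullet> a + u0 \<bullet> b"
      using FP by linarith
    then show ?thesis
      by (simp add: power2_norm_eq_inner inner_add inner_commute)
  qed
  \<comment> \<open>By \<open>key\<close> this point is monotonically related to all of
    \<open>G\<close>, hence a member; inserting the point itself into \<open>key\<close> then makes
    the right side vanish.\<close>
  have mem: "(- u0, - x0) \<in> G"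
  proof (rule max)
    fix a b assume "(a, b) \<in> G"
    then have "0 \<le> (a + u0) \<bullet> (b + x0)" using key zero_le_power2 order_trans by blast
    then show "0 \<le> (- u0 - a) \<bullet> (- x0 - b)"
      by (simp add: inner_add inner_diff inner_commute)
  qed
  have "x0 + u0 = 0" using key[OF mem] by simp
  then have "u0 = - x0" by (simp add: eq_neg_iff_add_eq_0 add.commute)
  then show thesis using mem that by simp
qed

text \<open>The graph of \<open>lam *\<^sub>R A - y\<close> inherits maximal monotonicity, and a
  zero of its sum with the identity, as given by \<open>minty_zero\<close>, solves the
  inclusion.\<close>

lemma minty:
  fixes A :: "'a::{real_inner,complete_space} \<Rightarrow> 'a set"
  assumes A: "maximally_monotone A" and lam: "lam > 0"
  obtains x b where "b \<in> A x" "y = x + lam *\<^sub>R b"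
proof -
  define G where "G = {(a, lam *\<^sub>R b - y) | a b. b \<in> A a}"
  obtain x where "(x, - x) \<in> G"
  proof (rule minty_zero[of G])
    fix x u a b assume "(x, u) \<in> G" "(a, b) \<in> G"
    then obtain u' b' where *: "u' \<in> A x" "b' \<in> A a" "u = lam *\<^sub>R u' - y" "b = lam *\<^sub>R b' - y"
      by (auto simp: G_def)
    have "u - b = lam *\<^sub>R (u' - b')" by (simp add: *(3,4) algebra_simps)
    then have "(x - a) \<bullet> (u - b) = lam * ((x - a) \<bullet> (u' - b'))" by simp
    then show "0 \<le> (x - a) \<bullet> (u - b)"
      using maximally_monotone_mono[OF A *(1,2)] lam by simp
  next
    fix x u assume *: "\<And>a b. (a, b) \<in> G \<Longrightarrow> 0 \<le> (x - a) \<bullet> (u - b)"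
    have "(1 / lam) *\<^sub>R (u + y) \<in> A x"
    proof (rule maximally_monotone_mem[OF A])
      fix a b assume "b \<in> A a"
      then have "0 \<le> (x - a) \<bullet> (u - (lam *\<^sub>R b - y))" using * by (auto simp: G_def)
      also have "u - (lam *\<^sub>R b - y) = lam *\<^sub>R ((1 / lam) *\<^sub>R (u + y) - b)"
        using lam by (simp add: algebra_simps)
      finally show "0 \<le> (x - a) \<bullet> ((1 / lam) *\<^sub>R (u + y) - b)"
        using lam by (simp add: zero_le_mult_iff)
    qed
    then show "(x, u) \<in> G" using lam by (force simp: G_def)
  qed (use that in blast)
  then obtain b where "b \<in> A x" "- x = lam *\<^sub>R b - y" by (auto simp: G_def)
  then show thesis using that[of b x] by (simp add: algebra_simps)
qed

text \<open>Two solutions satisfy \<open>x - x' = lam *\<^sub>R (b' - b)\<close>, so monotonicity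
  forces their squared distance to be nonpositive. This settles the uniqueness behind the definite
  description.\<close>

lemma resolvent_eqI:
  fixes A :: "'a::{real_inner,complete_space} \<Rightarrow> 'a set"
  assumes A: "maximally_monotone A" and lam: "lam > 0" and b: "b \<in> A x" "y = x + lam *\<^sub>R b"
  shows "resolvent lam A y = x"
proof -
  have iff: "x \<in> op_inverse (\<lambda>x. {x} + (\<lambda>u. lam *\<^sub>R u) ` A x) y \<longleftrightarrow> (\<exists>b\<in>A x. y = x + lam *\<^sub>R b)"
    for x by (auto simp: op_inverse_def set_plus_def)
  show ?thesis unfolding resolvent_def iff
  proof (rule the_equality)
    show "\<exists>b\<in>A x. y = x + lam *\<^sub>R b" using b by blast
  next
    fix x' assume "\<exists>b\<in>A x'. y = x' + lam *\<^sub>R b"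
    then obtain b' where b': "b' \<in> A x'" "y = x' + lam *\<^sub>R b'" by blast
    have "lam *\<^sub>R (b' - b) = x - x'" using b b' by (simp add: algebra_simps)
    then have "lam * ((x' - x) \<bullet> (b' - b)) = (x' - x) \<bullet> (x - x')"
      by (metis inner_scaleR_right)
    also have "\<dots> = - ((norm (x' - x))\<^sup>2)"
      by (simp add: power2_norm_eq_inner inner_diff inner_commute)
    finally have "(norm (x' - x))\<^sup>2 = - (lam * ((x' - x) \<bullet> (b' - b)))" by simp
    moreover have "0 \<le> lam * ((x' - x) \<bullet> (b' - b))"
      using maximally_monotone_mono[OF A b'(1) b(1)] lam by simp
    ultimately have "(norm (x' - x))\<^sup>2 \<le> 0" by linarith
    then show "x' = x" by simp
  qed
qed

lemma resolvent_mem: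
  fixes A :: "'a::{real_inner,complete_space} \<Rightarrow> 'a set"
  assumes A: "maximally_monotone A" and lam: "lam > 0"
  shows "(1 / lam) *\<^sub>R (y - resolvent lam A y) \<in> A (resolvent lam A y)"
proof -
  obtain x b where b: "b \<in> A x" "y = x + lam *\<^sub>R b" using minty[OF A lam] by blast
  have "resolvent lam A y = x" using resolvent_eqI[OF A lam b] .
  then show ?thesis using b lam by simp
qed

section \<open>Weak cluster points\<close>

text \<open>Inner products embed the sequences in a product of compact intervals, one factor for
  each index and test vector. Tychonoff gives a cluster point, which is linear and bounded in the
  test vector and hence represented by Riesz. One filter serves all indices at once.\<close>

lemma weak_cluster_filter:
  fixes v :: "'i \<Rightarrow> nat \<Rightarrow> 'a::{real_inner,complete_space}"
  assumes F: "F \<noteq> bot" and bd: "\<And>i. bounded (range (v i))"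
  obtains F' c where "F' \<le> F" "F' \<noteq> bot"
    "\<And>i u. ((\<lambda>k. v i k \<bullet> u) \<longlongrightarrow> c i \<bullet> u) F'"
proof -
  obtain M where M: "\<And>i k. norm (v i k) \<le> M i"
    using bd unfolding bounded_iff by (metis rangeI)
  define \<phi> where "\<phi> k = (\<lambda>(i, u). v i k \<bullet> u)" for k
  define K where "K = (PiE UNIV (\<lambda>(i, u :: 'a). {- (M i * norm u) .. M i * norm u}))"
  have "compactin (product_topology (\<lambda>_. euclidean) UNIV) K"
    unfolding K_def compactin_PiE by (auto simp: split_def)
  then have K: "compact K" by (simp add: euclidean_product_topology)
  have in_K: "\<phi> k \<in> K" for k
  proof -
    have "\<bar>v i k \<bullet> u\<bar> \<le> M i * norm u" for i u
      using Cauchy_Schwarz_ineq2[of "v i k" u] mult_right_mono[OF M[of i k], of "norm u"] by simp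
    then have "v i k \<bullet> u \<in> {- (M i * norm u) .. M i * norm u}" for i u
      by (simp add: abs_le_iff minus_le_iff)
    then show ?thesis unfolding K_def \<phi>_def by (auto simp del: atLeastAtMost_iff)
  qed
  have "filtermap \<phi> F \<noteq> bot" using F by (simp add: filtermap_bot_iff)
  moreover have "eventually (\<lambda>f. f \<in> K) (filtermap \<phi> F)"
    by (simp add: eventually_filtermap in_K)
  ultimately obtain f where f: "f \<in> K" "inf (nhds f) (filtermap \<phi> F) \<noteq> bot"
    using K unfolding compact_filter by blast
  \<comment> \<open>Pulling the neighbourhoods of \<open>f\<close> back along \<open>\<phi>\<close>
    refines \<open>F\<close> so that \<open>\<phi>\<close> tends to \<open>f\<close>; the result is
    proper because \<open>f\<close> is a cluster point of the image filter.\<close>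
  define F' where "F' = inf F (filtercomap \<phi> (nhds f))"
  have F': "F' \<noteq> bot"
  proof
    assume "F' = bot"
    then have "eventually (\<lambda>_. False) F'" by simp
    then obtain P Q where P: "eventually P F" and Q: "eventually Q (filtercomap \<phi> (nhds f))"
      and PQ: "\<And>k. P k \<Longrightarrow> Q k \<Longrightarrow> False"
      unfolding F'_def eventually_inf by blast
    obtain R where R: "eventually R (nhds f)" "\<And>k. R (\<phi> k) \<Longrightarrow> Q k"
      using Q unfolding eventually_filtercomap by blast
    have "eventually (\<lambda>g. \<not> R g) (filtermap \<phi> F)"
      unfolding eventually_filtermap using P by eventually_elim (use PQ R(2) in blast)
    then have "eventually (\<lambda>_. False) (inf (nhds f) (filtermap \<phi> F))"
      unfolding eventually_inf using R(1) by blast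
    then show False using f(2) by (simp add: eventually_False)
  qed
  have \<phi>_lim: "filterlim \<phi> (nhds f) F'"
    unfolding F'_def filterlim_def using filtermap_filtercomap le_inf_iff
    by (metis filtermap_mono inf_le2 order_trans)
  have lim: "((\<lambda>k. v i k \<bullet> u) \<longlongrightarrow> f (i, u)) F'" for i u
  proof (rule topological_tendstoI)
    fix S :: "real set" assume S: "open S" "f (i, u) \<in> S"
    have "open ((\<lambda>g :: 'i \<times> 'a \<Rightarrow> real. g (i, u)) -` S)"
      using continuous_on_open_vimage[of UNIV "\<lambda>g :: 'i \<times> 'a \<Rightarrow> real. g (i, u)"] S(1) by simp
    then have "eventually (\<lambda>g. g (i, u) \<in> S) (nhds f)"
      using S(2) unfolding eventually_nhds by fastforce
    then have "eventually (\<lambda>k. \<phi> k (i, u) \<in> S) F'"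
      using \<phi>_lim by (rule eventually_compose_filterlim)
    then show "eventually (\<lambda>k. v i k \<bullet> u \<in> S) F'" by (simp add: \<phi>_def)
  qed
  have "bounded_linear (\<lambda>u. f (i, u))" for i
  proof (rule bounded_linear_intro[where K = "M i"])
    fix u w
    have "((\<lambda>k. v i k \<bullet> (u + w)) \<longlongrightarrow> f (i, u) + f (i, w)) F'"
      unfolding inner_add_right by (intro tendsto_intros lim)
    from tendsto_unique[OF F' lim this] show "f (i, u + w) = f (i, u) + f (i, w)" .
  next
    fix r u
    have "((\<lambda>k. v i k \<bullet> (r *\<^sub>R u)) \<longlongrightarrow> r * f (i, u)) F'"
      unfolding inner_scaleR_right by (intro tendsto_intros lim)
    from tendsto_unique[OF F' lim this] show "f (i, r *\<^sub>R u) = r *\<^sub>R f (i, u)" by simp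
  next
    fix u
    have "f (i, u) \<in> {- (M i * norm u) .. M i * norm u}"
      using f(1) unfolding K_def by (auto simp: PiE_iff)
    then show "norm (f (i, u)) \<le> norm u * M i" by (simp add: abs_le_iff mult.commute)
  qed
  then have "\<exists>c. \<forall>u. f (i, u) = c \<bullet> u" for i using riesz_representation by metis
  then obtain c where "\<And>i u. f (i, u) = c i \<bullet> u" by metis
  then show thesis using that[of F' c] F' lim by (simp add: F'_def)
qed

text \<open>Were convergence to fail, the inner products with \<open>u\<close> would stay
  \<open>e\<close> away from the limit along infinitely many indices; a cluster filter inside that
  index set contradicts uniqueness.\<close>

lemma weak_limit_of_unique_cluster:
  fixes v :: "'i \<Rightarrow> nat \<Rightarrow> 'a::{real_inner,complete_space}"
  assumes bd: "\<And>i. bounded (range (v i))"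
    and unique: "\<And>F c. F \<le> sequentially \<Longrightarrow> F \<noteq> bot \<Longrightarrow>
      (\<And>i u. ((\<lambda>k. v i k \<bullet> u) \<longlongrightarrow> c i \<bullet> u) F) \<Longrightarrow> c j = w"
  shows "(\<lambda>k. v j k \<bullet> u) \<longlonglongrightarrow> w \<bullet> u"
proof (rule ccontr)
  assume "\<not> ?thesis"
  then obtain e where e: "e > 0" "\<not> eventually (\<lambda>k. dist (v j k \<bullet> u) (w \<bullet> u) < e) sequentially"
    unfolding tendsto_iff by blast
  define F where "F = inf sequentially (principal {k. \<not> dist (v j k \<bullet> u) (w \<bullet> u) < e})"
  have "F \<noteq> bot"
    using e(2) by (simp add: F_def trivial_limit_def eventually_inf_principal)
  then obtain F' c where F': "F' \<le> F" "F' \<noteq> bot"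
    and c: "\<And>i u. ((\<lambda>k. v i k \<bullet> u) \<longlongrightarrow> c i \<bullet> u) F'"
    using weak_cluster_filter[of F v] bd by blast
  have "F' \<le> sequentially" using F'(1) by (simp add: F_def)
  then have "c j = w" using unique F'(2) c by blast
  then have "((\<lambda>k. v j k \<bullet> u) \<longlongrightarrow> w \<bullet> u) F'" using c by blast
  then have "eventually (\<lambda>k. dist (v j k \<bullet> u) (w \<bullet> u) < e) F'"
    using e(1) by (simp add: tendsto_iff)
  moreover have "eventually (\<lambda>k. \<not> dist (v j k \<bullet> u) (w \<bullet> u) < e) F'"
    by (rule filter_leD[OF F'(1)]) (simp add: F_def eventually_inf_principal)
  ultimately have "eventually (\<lambda>_. False) F'" by eventually_elim blast
  then show False using F'(2) by (simp add: eventually_False)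
qed

text \<open>Split \<open>b k \<bullet> a k\<close> as
  \<open>b k \<bullet> (a k - a0) + b k \<bullet> a0\<close>. Boundedness is a separate premise
  because weak convergence along a general filter does not yield it.\<close>

lemma tendsto_inner_strong_weak:
  fixes a b :: "nat \<Rightarrow> 'a::real_inner"
  assumes a: "(a \<longlongrightarrow> a0) F" and b: "\<And>u. ((\<lambda>k. b k \<bullet> u) \<longlongrightarrow> b0 \<bullet> u) F"
    and bd: "bounded (range b)"
  shows "((\<lambda>k. b k \<bullet> a k) \<longlongrightarrow> b0 \<bullet> a0) F"
proof -
  obtain M where M: "\<And>k. norm (b k) \<le> M"
    using bd unfolding bounded_iff by blast
  have "((\<lambda>k. b k \<bullet> (a k - a0)) \<longlongrightarrow> 0) F"
  proof (rule Lim_null_comparison)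
    show "eventually (\<lambda>k. norm (b k \<bullet> (a k - a0)) \<le> M * norm (a k - a0)) F"
    proof (rule always_eventually, rule allI)
      fix k show "norm (b k \<bullet> (a k - a0)) \<le> M * norm (a k - a0)"
        using Cauchy_Schwarz_ineq2[of "b k" "a k - a0"] mult_right_mono[OF M[of k], of "norm (a k - a0)"]
        by simp
    qed
    have "((\<lambda>k. M * norm (a k - a0)) \<longlongrightarrow> M * norm (a0 - a0)) F" by (intro tendsto_intros a)
    then show "((\<lambda>k. M * norm (a k - a0)) \<longlongrightarrow> 0) F" by simp
  qed
  from tendsto_add[OF this b[of a0]] show ?thesis by (simp add: inner_diff_right)
qed

text \<open>The infimum over the graph of each \<open>A i\<close> is at most \<open>0\<close>, so nonnegativity of the sum over
  all selections passes to each summand.\<close>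

lemma maximally_monotone_mem_sum:
  fixes A :: "nat \<Rightarrow> 'a::real_inner \<Rightarrow> 'a set"
  assumes A: "\<And>i. i \<in> I \<Longrightarrow> maximally_monotone (A i)" and "finite I"
    and sum: "\<And>p q. (\<And>i. i \<in> I \<Longrightarrow> q i \<in> A i (p i)) \<Longrightarrow> 0 \<le> (\<Sum>i\<in>I. (x i - p i) \<bullet> (a i - q i))"
    and j: "j \<in> I"
  shows "a j \<in> A j (x j)"
proof (rule maximally_monotone_mem[OF A[OF j]])
  fix r s assume rs: "s \<in> A j r"
  have "\<exists>p q. q \<in> A i p \<and> (x i - p) \<bullet> (a i - q) \<le> 0" if i: "i \<in> I" for i
  proof (cases "a i \<in> A i (x i)")
    case True then show ?thesis by (intro exI[of _ "x i"] exI[of _ "a i"]) simp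
  next
    case False then show ?thesis using maximally_monotone_mem[OF A[OF i]] by (meson linear)
  qed
  then obtain p q where pq: "\<And>i. i \<in> I \<Longrightarrow> q i \<in> A i (p i) \<and> (x i - p i) \<bullet> (a i - q i) \<le> 0"
    by metis
  have "0 \<le> (\<Sum>i\<in>I. (x i - (p(j := r)) i) \<bullet> (a i - (q(j := s)) i))"
    using pq rs by (intro sum) auto
  also have "\<dots> = (x j - r) \<bullet> (a j - s) + (\<Sum>i\<in>I - {j}. (x i - p i) \<bullet> (a i - q i))"
    by (subst sum.remove[OF \<open>finite I\<close> j]) simp
  also have "(\<Sum>i\<in>I - {j}. (x i - p i) \<bullet> (a i - q i)) \<le> 0" using pq by (intro sum_nonpos) auto
  finally show "0 \<le> (x j - r) \<bullet> (a j - s)" by simp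
qed

section \<open>The Fejer inequality\<close>

lemma sum_atMost_drop_zero:
  fixes f :: "nat \<Rightarrow> 'b::comm_monoid_add"
  assumes "f 0 = 0"
  shows "(\<Sum>i\<le>N. f i) = (\<Sum>i=1..N. f i)"
  using assms by (intro sum.mono_neutral_right) (auto simp: Suc_le_eq)

lemma sum_by_parts_inner:
  fixes d e :: "nat \<Rightarrow> 'a::real_inner"
  shows "(\<Sum>i\<le>N. d (Suc i) \<bullet> (e (Suc i) - e i))
    = d (Suc N) \<bullet> e (Suc N) - d 0 \<bullet> e 0 - (\<Sum>i\<le>N. e i \<bullet> (d (Suc i) - d i))"
  by (induction N) (simp_all add: inner_diff inner_commute)

lemma sum_inner_backward_diff:
  fixes d :: "nat \<Rightarrow> 'a::real_inner"
  shows "(\<Sum>i\<le>N. d (Suc i) \<bullet> (d i - d (Suc i)))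
    = ((norm (d 0))\<^sup>2 - (norm (d (Suc N)))\<^sup>2 - (\<Sum>i\<le>N. (norm (d (Suc i) - d i))\<^sup>2)) / 2"
  by (induction N) (simp_all add: power2_norm_eq_inner inner_diff inner_commute field_simps)

text \<open>The choices \<open>e 0 = e (N + 1) = d 0 = d 1\<close> close the ring: all boundary terms of the two
  summations by parts collapse to \<open>- \<parallel>d (N + 1) - d 1\<parallel>\<^sup>2 / 2 \<le> 0\<close>.\<close>

lemma fejer_inequality:
  fixes d e b :: "nat \<Rightarrow> 'a::real_inner"
  assumes ring: "e 0 = d 1" "e (Suc N) = d 1" "d 0 = d 1" "b 0 = 0"
    and mono: "0 \<le> (\<Sum>i\<le>N. d (Suc i) \<bullet> (e (Suc i) - e i + d i - d (Suc i) - lam *\<^sub>R b i))"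
    and coc: "\<And>i. i \<in> {1..N} \<Longrightarrow> (norm (b i))\<^sup>2 / L \<le> b i \<bullet> d i"
    and pos: "lam > 0" "c > 0" "\<gamma> > 0"
  shows "(\<Sum>i=1..N. (norm (e i + \<gamma> *\<^sub>R (d (Suc i) - d i)))\<^sup>2)
    \<le> (\<Sum>i=1..N. (norm (e i))\<^sup>2)
       - \<gamma> * (1 - \<gamma> - c) * (\<Sum>i=1..N. (norm (d (Suc i) - d i))\<^sup>2)
       - 2 * \<gamma> * (lam / L - lam\<^sup>2 / (2 * c)) * (\<Sum>i=1..N. (norm (b i))\<^sup>2)"
proof -
  define D where "D = (\<Sum>i=1..N. (norm (d (Suc i) - d i))\<^sup>2)"
  define S where "S = (\<Sum>i=1..N. (norm (b i))\<^sup>2)"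
  define C where "C = (\<Sum>i=1..N. e i \<bullet> (d (Suc i) - d i))"
  have D0: "D = (\<Sum>i\<le>N. (norm (d (Suc i) - d i))\<^sup>2)"
    and S0: "S = (\<Sum>i\<le>N. (norm (b i))\<^sup>2)"
    and C0: "C = (\<Sum>i\<le>N. e i \<bullet> (d (Suc i) - d i))"
    unfolding D_def S_def C_def using ring by (subst sum_atMost_drop_zero; simp)+
  have coc0: "(norm (b i))\<^sup>2 / L \<le> b i \<bullet> d i" if "i \<le> N" for i
    using that coc[of i] ring(4) by (cases "i = 0") auto
  have young: "- lam * (d (Suc i) \<bullet> b i)
      \<le> (c / 2) * (norm (d (Suc i) - d i))\<^sup>2 - (lam / L - lam\<^sup>2 / (2 * c)) * (norm (b i))\<^sup>2"
    if i: "i \<le> N" for i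
  proof -
    \<comment> \<open>Young's inequality with weight \<open>c\<close>, from expanding this square.
      It trades \<open>d (Suc i)\<close> for \<open>d i\<close> in the pairing with
      \<open>b i\<close>, where cocoercivity applies.\<close>
    have "0 \<le> (norm (c *\<^sub>R (d (Suc i) - d i) + lam *\<^sub>R b i))\<^sup>2 / (2 * c)" using pos by simp
    also have "(norm (c *\<^sub>R (d (Suc i) - d i) + lam *\<^sub>R b i))\<^sup>2
      = c\<^sup>2 * (norm (d (Suc i) - d i))\<^sup>2 + 2 * c * lam * ((d (Suc i) - d i) \<bullet> b i)
        + lam\<^sup>2 * (norm (b i))\<^sup>2"
      by (simp only: power2_norm_eq_inner)
         (simp add: inner_add inner_commute power2_eq_square)
    also have "\<dots> / (2 * c) = (c / 2) * (norm (d (Suc i) - d i))\<^sup>2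
        + lam * ((d (Suc i) - d i) \<bullet> b i) + lam\<^sup>2 / (2 * c) * (norm (b i))\<^sup>2"
      using pos by (simp add: field_simps power2_eq_square)
    finally have "- lam * (d (Suc i) \<bullet> b i) \<le> (c / 2) * (norm (d (Suc i) - d i))\<^sup>2
        - lam * (d i \<bullet> b i) + lam\<^sup>2 / (2 * c) * (norm (b i))\<^sup>2"
      by (simp add: inner_diff_left algebra_simps)
    moreover have "lam / L * (norm (b i))\<^sup>2 \<le> lam * (d i \<bullet> b i)"
      using mult_left_mono[OF coc0[OF i], of lam] pos by (simp add: inner_commute)
    ultimately show ?thesis by (simp add: left_diff_distrib)
  qed
  have "(\<Sum>i\<le>N. d (Suc i) \<bullet> (e (Suc i) - e i + d i - d (Suc i) - lam *\<^sub>R b i))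
     = (\<Sum>i\<le>N. d (Suc i) \<bullet> (e (Suc i) - e i)) + (\<Sum>i\<le>N. d (Suc i) \<bullet> (d i - d (Suc i)))
       + (\<Sum>i\<le>N. - lam * (d (Suc i) \<bullet> b i))"
    unfolding sum.distrib[symmetric]
    by (intro sum.cong refl) (simp add: inner_diff_right inner_add_right)
  also have "\<dots> = - (norm (d (Suc N) - d 1))\<^sup>2 / 2 - C - D / 2 + (\<Sum>i\<le>N. - lam * (d (Suc i) \<bullet> b i))"
    unfolding sum_by_parts_inner sum_inner_backward_diff C0[symmetric] D0[symmetric] ring
    by (simp add: power2_norm_eq_inner inner_diff inner_commute field_simps)
  finally have "0 \<le> - (norm (d (Suc N) - d 1))\<^sup>2 / 2 - C - D / 2 + (\<Sum>i\<le>N. - lam * (d (Suc i) \<bullet> b i))"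
    using mono by simp
  moreover have "(\<Sum>i\<le>N. - lam * (d (Suc i) \<bullet> b i)) \<le> (c / 2) * D - (lam / L - lam\<^sup>2 / (2 * c)) * S"
    unfolding D0 S0 sum_distrib_left sum_subtractf[symmetric] by (intro sum_mono young) simp
  ultimately have "C \<le> - D / 2 + (c / 2) * D - (lam / L - lam\<^sup>2 / (2 * c)) * S"
    using zero_le_power2[of "norm (d (Suc N) - d 1)"] by argo
  then have "2 * \<gamma> * C \<le> 2 * \<gamma> * (- D / 2 + (c / 2) * D - (lam / L - lam\<^sup>2 / (2 * c)) * S)"
    using pos by (intro mult_left_mono) auto
  moreover have "(\<Sum>i=1..N. (norm (e i + \<gamma> *\<^sub>R (d (Suc i) - d i)))\<^sup>2)
      = (\<Sum>i=1..N. (norm (e i))\<^sup>2) + 2 * \<gamma> * C + \<gamma>\<^sup>2 * D"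
    unfolding C_def D_def sum_distrib_left sum.distrib[symmetric]
    by (intro sum.cong refl, simp only: power2_norm_eq_inner)
       (simp add: inner_add inner_commute power2_eq_square)
  ultimately show ?thesis
    unfolding D_def[symmetric] S_def[symmetric] by (simp add: algebra_simps power2_eq_square)
qed

lemma tendsto_zero_of_descent:
  fixes s r :: "nat \<Rightarrow> real"
  assumes "\<And>k. 0 \<le> s k" "\<And>k. 0 \<le> r k" "\<And>k. s (Suc k) \<le> s k - r k"
  shows "convergent s" "r \<longlonglongrightarrow> 0" "\<And>k. s k \<le> s 0"
proof -
  have dec: "decseq s" using assms(2,3) by (intro decseq_SucI) (smt (verit))
  show "s k \<le> s 0" for k using dec by (simp add: decseq_def)
  obtain l where l: "s \<longlonglongrightarrow> l" using decseq_convergent[OF dec] assms(1) by blast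
  then show "convergent s" by (auto simp: convergent_def)
  have "(\<lambda>k. s k - s (Suc k)) \<longlonglongrightarrow> l - l" by (intro tendsto_intros l LIMSEQ_Suc)
  then have "(\<lambda>k. s k - s (Suc k)) \<longlonglongrightarrow> 0" by simp
  moreover have "r k \<le> s k - s (Suc k)" for k using assms(3)[of k] by simp
  ultimately show "r \<longlonglongrightarrow> 0"
    using assms(2) by (intro tendsto_sandwich[of "\<lambda>_. 0" r _ "\<lambda>k. s k - s (Suc k)"]) auto
qed

section \<open>The iteration around the ring\<close>

text \<open>All sequences are extended around the ring: \<open>Z k 0\<close>, \<open>Z k (N + 1)\<close> and \<open>X k 0\<close> all stand for
  \<open>x\<^sub>1\<close>, and \<open>B 0 = 0\<close>. This makes the first, the middle and the last resolvent step instances of one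
  formula; \<open>N\<close> is \<open>n - 1\<close>.\<close>

locale ring_splitting =
  fixes A :: "nat \<Rightarrow> 'a::{real_inner, complete_space} \<Rightarrow> 'a set"
    and B :: "nat \<Rightarrow> 'a \<Rightarrow> 'a"
    and N :: nat
    and L lam \<gamma> :: real
    and Z X :: "nat \<Rightarrow> nat \<Rightarrow> 'a"
  assumes L_pos: "L > 0" and lam_pos: "lam > 0"
    and N_pos: "N \<ge> 1"
    and \<gamma>_pos: "\<gamma> > 0" and \<gamma>_less: "\<gamma> < 1 - lam * L / 2"
    and A_max: "\<And>i. i \<le> N \<Longrightarrow> maximally_monotone (A (Suc i))"
    and B_coc: "\<And>i. i \<le> N \<Longrightarrow> cocoercive (1 / L) (B i)"
    and B_0: "B 0 = (\<lambda>_. 0)"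
    and X_0: "X k 0 = X k 1" and Z_0: "Z k 0 = X k 1" and Z_Suc: "Z k (Suc N) = X k 1"
    and X_mem: "\<And>i. i \<le> N \<Longrightarrow>
      (1 / lam) *\<^sub>R (Z k (Suc i) - Z k i + X k i - X k (Suc i)) - B i (X k i) \<in> A (Suc i) (X k (Suc i))"
    and Z_step: "\<And>i. i \<in> {1..N} \<Longrightarrow> Z (Suc k) i = Z k i + \<gamma> *\<^sub>R (X k (Suc i) - X k i)"
begin

text \<open>The fixed points \<open>w\<close> of the iteration, extended around the ring by \<open>w 0 = w (N + 1) = p\<close>.\<close>

definition solution :: "(nat \<Rightarrow> 'a) \<Rightarrow> 'a \<Rightarrow> bool" where
  "solution w p \<longleftrightarrow> w 0 = p \<and> w (Suc N) = p
     \<and> (\<forall>i\<le>N. (1 / lam) *\<^sub>R (w (Suc i) - w i) - B i p \<in> A (Suc i) p)"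

text \<open>In one direction the differences of \<open>w\<close> telescope around the closed ring.
  Conversely, scaled partial sums started at \<open>p\<close> close up because the total
  vanishes.\<close>

lemma solution_iff_sum_zero:
  "(\<exists>w. solution w p) \<longleftrightarrow> (\<exists>a. (\<forall>i\<le>N. a i \<in> A (Suc i) p) \<and> (\<Sum>i\<le>N. a i + B i p) = 0)"
proof
  assume "\<exists>w. solution w p"
  then obtain w where w: "solution w p" by blast
  define a where "a i = (1 / lam) *\<^sub>R (w (Suc i) - w i) - B i p" for i
  have "(\<Sum>i\<le>N. a i + B i p) = (1 / lam) *\<^sub>R (\<Sum>i\<le>N. w (Suc i) - w i)"
    by (simp add: a_def scaleR_sum_right)
  also have "(\<Sum>i\<le>N. w (Suc i) - w i) = w (Suc N) - w 0"
    by (induction N) simp_all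
  finally have "(\<Sum>i\<le>N. a i + B i p) = 0" using w by (simp add: solution_def)
  then show "\<exists>a. (\<forall>i\<le>N. a i \<in> A (Suc i) p) \<and> (\<Sum>i\<le>N. a i + B i p) = 0"
    using w by (auto simp: solution_def a_def)
next
  assume "\<exists>a. (\<forall>i\<le>N. a i \<in> A (Suc i) p) \<and> (\<Sum>i\<le>N. a i + B i p) = 0"
  then obtain a where a: "\<forall>i\<le>N. a i \<in> A (Suc i) p" "(\<Sum>i\<le>N. a i + B i p) = 0" by blast
  define w where "w i = p + lam *\<^sub>R (\<Sum>j<i. a j + B j p)" for i
  have "(1 / lam) *\<^sub>R (w (Suc i) - w i) - B i p = a i" for i
    using lam_pos by (simp add: w_def scaleR_add_right)
  moreover have "w 0 = p" "w (Suc N) = p"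
    using a(2) by (simp_all only: w_def lessThan_Suc_atMost) simp_all
  ultimately show "\<exists>w. solution w p" using a(1) by (auto simp: solution_def)
qed

section \<open>Fejer monotonicity of the iterates\<close>

lemma A_mono:
  "i \<le> N \<Longrightarrow> u \<in> A (Suc i) p \<Longrightarrow> v \<in> A (Suc i) q \<Longrightarrow> 0 \<le> (p - q) \<bullet> (u - v)"
  using maximally_monotone_mono[OF A_max] .

lemma B_coc_ineq: "i \<le> N \<Longrightarrow> (norm (B i p - B i q))\<^sup>2 / L \<le> (B i p - B i q) \<bullet> (p - q)"
  using B_coc unfolding cocoercive_def by simp

text \<open>Monotonicity of each \<open>A (Suc i)\<close> between iterate and solution, scaled by
  \<open>lam\<close>, supplies the premise \<open>mono\<close> of
  \<open>fejer_inequality\<close>.\<close>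

lemma descent:
  obtains \<alpha> \<beta> where "\<alpha> > 0" "\<beta> > 0"
    "\<And>w p k. solution w p \<Longrightarrow> (\<Sum>i=1..N. (norm (Z (Suc k) i - w i))\<^sup>2)
      \<le> (\<Sum>i=1..N. (norm (Z k i - w i))\<^sup>2)
         - (\<alpha> * (\<Sum>i=1..N. (norm (X k (Suc i) - X k i))\<^sup>2)
            + \<beta> * (\<Sum>i=1..N. (norm (B i (X k i) - B i p))\<^sup>2))"
proof -
  \<comment> \<open>The midpoint between \<open>lam * L / 2\<close> and \<open>1 - \<gamma>\<close>,
    which are separated by the bound on \<open>\<gamma>\<close>. Staying below the upper end makes
    the first coefficient positive, staying above the lower end the second.\<close>
  define c where "c = (lam * L / 2 + (1 - \<gamma>)) / 2"
  have lamL: "0 < lam * L" using L_pos lam_pos by simp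
  have c: "lam * L / 2 < c" "c < 1 - \<gamma>" "0 < c" using \<gamma>_less lamL unfolding c_def by argo+
  have "lam\<^sup>2 * L < lam * (2 * c)" using c(1) lam_pos by (simp add: power2_eq_square)
  then have \<beta>: "0 < lam / L - lam\<^sup>2 / (2 * c)" using c L_pos by (simp add: field_simps)
  show thesis
  proof (rule that[of "\<gamma> * (1 - \<gamma> - c)" "2 * \<gamma> * (lam / L - lam\<^sup>2 / (2 * c))"])
    show "0 < \<gamma> * (1 - \<gamma> - c)" using \<gamma>_pos c by simp
    show "0 < 2 * \<gamma> * (lam / L - lam\<^sup>2 / (2 * c))" using \<gamma>_pos \<beta> by simp
    fix w p k assume sol: "solution w p"
    define d e b where "d i = X k i - p" and "e i = Z k i - w i" and "b i = B i (X k i) - B i p" for i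
    have ring: "e 0 = d 1" "e (Suc N) = d 1" "d 0 = d 1" "b 0 = 0"
      using sol by (simp_all add: d_def e_def b_def solution_def X_0 Z_0 Z_Suc B_0)
    have "0 \<le> (\<Sum>i\<le>N. d (Suc i) \<bullet> (e (Suc i) - e i + d i - d (Suc i) - lam *\<^sub>R b i))"
    proof (rule sum_nonneg)
      fix i assume "i \<in> {..N}"
      then have i: "i \<le> N" by simp
      have "0 \<le> lam * ((X k (Suc i) - p) \<bullet>
        ((1 / lam) *\<^sub>R (Z k (Suc i) - Z k i + X k i - X k (Suc i)) - B i (X k i)
          - ((1 / lam) *\<^sub>R (w (Suc i) - w i) - B i p)))"
        using sol i X_mem[OF i] lam_pos by (intro mult_nonneg_nonneg A_mono) (auto simp: solution_def)
      also have "\<dots> = (X k (Suc i) - p) \<bullet> (lam *\<^sub>R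
        ((1 / lam) *\<^sub>R (Z k (Suc i) - Z k i + X k i - X k (Suc i)) - B i (X k i)
          - ((1 / lam) *\<^sub>R (w (Suc i) - w i) - B i p)))"
        by simp
      also have "lam *\<^sub>R ((1 / lam) *\<^sub>R (Z k (Suc i) - Z k i + X k i - X k (Suc i)) - B i (X k i)
          - ((1 / lam) *\<^sub>R (w (Suc i) - w i) - B i p))
        = e (Suc i) - e i + d i - d (Suc i) - lam *\<^sub>R b i"
        using lam_pos by (simp add: d_def e_def b_def algebra_simps)
      finally show "0 \<le> d (Suc i) \<bullet> (e (Suc i) - e i + d i - d (Suc i) - lam *\<^sub>R b i)"
        by (simp add: d_def)
    qed
    moreover have "(norm (b i))\<^sup>2 / L \<le> b i \<bullet> d i" if "i \<in> {1..N}" for i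
      using that B_coc_ineq[of i] by (simp add: b_def d_def)
    ultimately have *: "(\<Sum>i=1..N. (norm (e i + \<gamma> *\<^sub>R (d (Suc i) - d i)))\<^sup>2)
      \<le> (\<Sum>i=1..N. (norm (e i))\<^sup>2)
         - \<gamma> * (1 - \<gamma> - c) * (\<Sum>i=1..N. (norm (d (Suc i) - d i))\<^sup>2)
         - 2 * \<gamma> * (lam / L - lam\<^sup>2 / (2 * c)) * (\<Sum>i=1..N. (norm (b i))\<^sup>2)"
      using ring lam_pos c \<gamma>_pos by (intro fejer_inequality) auto
    have "(\<Sum>i=1..N. (norm (e i + \<gamma> *\<^sub>R (d (Suc i) - d i)))\<^sup>2)
        = (\<Sum>i=1..N. (norm (Z (Suc k) i - w i))\<^sup>2)"
      by (intro sum.cong refl) (simp add: Z_step e_def d_def algebra_simps)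
    with * show "(\<Sum>i=1..N. (norm (Z (Suc k) i - w i))\<^sup>2)
      \<le> (\<Sum>i=1..N. (norm (Z k i - w i))\<^sup>2)
         - (\<gamma> * (1 - \<gamma> - c) * (\<Sum>i=1..N. (norm (X k (Suc i) - X k i))\<^sup>2)
            + 2 * \<gamma> * (lam / L - lam\<^sup>2 / (2 * c)) * (\<Sum>i=1..N. (norm (B i (X k i) - B i p))\<^sup>2))"
      by (simp add: d_def e_def b_def)
  qed
qed

text \<open>Descent makes the squared distance to a solution convergent and its decrements null.
  Bounds on \<open>Z k\<close> at the two artificial indices come from \<open>X k 1\<close> instead
  of the distance.\<close>

lemma fejer_consequences:
  assumes sol: "solution w p"
  shows Z_dist_convergent: "convergent (\<lambda>k. \<Sum>i=1..N. (norm (Z k i - w i))\<^sup>2)"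
    and X_diff: "i \<le> N \<Longrightarrow> (\<lambda>k. X k (Suc i) - X k i) \<longlonglongrightarrow> 0"
    and B_lim: "i \<le> N \<Longrightarrow> (\<lambda>k. B i (X k i)) \<longlonglongrightarrow> B i p"
    and X_bounded: "i \<le> Suc N \<Longrightarrow> bounded (range (\<lambda>k. X k i))"
    and Z_bounded: "i \<le> Suc N \<Longrightarrow> bounded (range (\<lambda>k. Z k i))"
proof -
  obtain \<alpha> \<beta> where pos: "\<alpha> > 0" "\<beta> > 0" and desc:
    "\<And>w p k. solution w p \<Longrightarrow> (\<Sum>i=1..N. (norm (Z (Suc k) i - w i))\<^sup>2)
      \<le> (\<Sum>i=1..N. (norm (Z k i - w i))\<^sup>2)
         - (\<alpha> * (\<Sum>i=1..N. (norm (X k (Suc i) - X k i))\<^sup>2)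
            + \<beta> * (\<Sum>i=1..N. (norm (B i (X k i) - B i p))\<^sup>2))"
    by (rule descent) blast
  define s r where "s k = (\<Sum>i=1..N. (norm (Z k i - w i))\<^sup>2)"
    and "r k = \<alpha> * (\<Sum>i=1..N. (norm (X k (Suc i) - X k i))\<^sup>2)
            + \<beta> * (\<Sum>i=1..N. (norm (B i (X k i) - B i p))\<^sup>2)" for k
  have s_nonneg: "0 \<le> s k" for k by (simp add: s_def sum_nonneg)
  have r_nonneg: "0 \<le> r k" for k using pos by (simp add: r_def sum_nonneg)
  have s_step: "s (Suc k) \<le> s k - r k" for k using desc[OF sol] by (simp add: s_def r_def)
  note s = tendsto_zero_of_descent[of s r, OF s_nonneg r_nonneg s_step]
  show "convergent (\<lambda>k. \<Sum>i=1..N. (norm (Z k i - w i))\<^sup>2)" using s(1) unfolding s_def[abs_def] .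
  have null: "f \<longlonglongrightarrow> 0" if "\<mu> > 0" "\<And>k. \<mu> * (norm (f k))\<^sup>2 \<le> r k" for f :: "nat \<Rightarrow> 'a" and \<mu>
  proof -
    have "(\<lambda>k. sqrt (r k / \<mu>)) \<longlonglongrightarrow> sqrt (0 / \<mu>)" using that(1) by (intro tendsto_intros s(2)) auto
    then have "(\<lambda>k. sqrt (r k / \<mu>)) \<longlonglongrightarrow> 0" by simp
    moreover have "norm (f k) \<le> sqrt (r k / \<mu>)" for k
      using that by (intro real_le_rsqrt) (simp add: field_simps)
    ultimately show ?thesis by (intro Lim_null_comparison[of f "\<lambda>k. sqrt (r k / \<mu>)"]) auto
  qed
  show X_diff: "(\<lambda>k. X k (Suc i) - X k i) \<longlonglongrightarrow> 0" if i: "i \<le> N" for i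
  proof (cases "i = 0")
    case True then show ?thesis by (simp add: X_0)
  next
    case False
    then have mem: "i \<in> {1..N}" using i by simp
    show ?thesis
    proof (rule null[OF pos(1)])
      fix k
      have "(norm (X k (Suc i) - X k i))\<^sup>2 \<le> (\<Sum>i=1..N. (norm (X k (Suc i) - X k i))\<^sup>2)"
        using mem by (intro member_le_sum) auto
      then have "\<alpha> * (norm (X k (Suc i) - X k i))\<^sup>2 \<le> \<alpha> * (\<Sum>i=1..N. (norm (X k (Suc i) - X k i))\<^sup>2)"
        using pos by (intro mult_left_mono) auto
      also have "\<dots> \<le> r k" using pos by (simp add: r_def sum_nonneg)
      finally show "\<alpha> * (norm (X k (Suc i) - X k i))\<^sup>2 \<le> r k" .
    qed
  qed
  show "(\<lambda>k. B i (X k i)) \<longlonglongrightarrow> B i p" if i: "i \<le> N" for i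
  proof (cases "i = 0")
    case True then show ?thesis by (simp add: B_0)
  next
    case False
    then have mem: "i \<in> {1..N}" using i by simp
    have "(\<lambda>k. B i (X k i) - B i p) \<longlonglongrightarrow> 0"
    proof (rule null[OF pos(2)])
      fix k
      have "(norm (B i (X k i) - B i p))\<^sup>2 \<le> (\<Sum>i=1..N. (norm (B i (X k i) - B i p))\<^sup>2)"
        using mem by (intro member_le_sum) auto
      then have "\<beta> * (norm (B i (X k i) - B i p))\<^sup>2 \<le> \<beta> * (\<Sum>i=1..N. (norm (B i (X k i) - B i p))\<^sup>2)"
        using pos by (intro mult_left_mono) auto
      also have "\<dots> \<le> r k" using pos by (simp add: r_def sum_nonneg)
      finally show "\<beta> * (norm (B i (X k i) - B i p))\<^sup>2 \<le> r k" .
    qed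
    then show ?thesis by (simp add: LIM_zero_iff)
  qed
  have Z_dist: "norm (Z k i - w i) \<le> sqrt (s 0)" if "i \<in> {1..N}" for i k
  proof (rule real_le_rsqrt)
    have "(norm (Z k i - w i))\<^sup>2 \<le> s k" unfolding s_def using that by (intro member_le_sum) auto
    then show "(norm (Z k i - w i))\<^sup>2 \<le> s 0" using s(3)[of k] by linarith
  qed
  \<comment> \<open>Nonexpansiveness of the first resolvent, from monotonicity of
    \<open>A 1\<close>. It bounds \<open>X k 1\<close>, the value at both ends of the ring.\<close>
  have X_1: "norm (X k 1 - p) \<le> norm (Z k 1 - w 1)" for k
  proof -
    have "(1 / lam) *\<^sub>R (w (Suc 0) - w 0) - B 0 p \<in> A (Suc 0) p" "w 0 = p"
      using sol unfolding solution_def by blast+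
    then have "0 \<le> lam * ((X k 1 - p) \<bullet> ((1 / lam) *\<^sub>R (Z k 1 - X k 1) - (1 / lam) *\<^sub>R (w 1 - p)))"
      using A_mono[OF _ X_mem[of 0 k], of "(1 / lam) *\<^sub>R (w (Suc 0) - w 0) - B 0 p" p] lam_pos
      by (simp add: B_0 Z_0 X_0)
    also have "(1 / lam) *\<^sub>R (Z k 1 - X k 1) - (1 / lam) *\<^sub>R (w 1 - p)
        = (1 / lam) *\<^sub>R ((Z k 1 - w 1) - (X k 1 - p))"
      by (simp add: algebra_simps)
    also have "lam * ((X k 1 - p) \<bullet> \<dots>) = (X k 1 - p) \<bullet> ((Z k 1 - w 1) - (X k 1 - p))"
      using lam_pos by simp
    finally have "norm (X k 1 - p) * norm (X k 1 - p) \<le> (X k 1 - p) \<bullet> (Z k 1 - w 1)"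
      by (simp only: inner_diff_right[of _ "Z k 1 - w 1"] dot_square_norm power2_eq_square)
    also have "\<dots> \<le> norm (X k 1 - p) * norm (Z k 1 - w 1)" by (rule norm_cauchy_schwarz)
    finally show ?thesis by (cases "X k 1 = p") auto
  qed
  have bounded_shift: "bounded (range f)" if "\<And>k. norm (f k - v) \<le> M" for f :: "nat \<Rightarrow> 'a" and v M
  proof -
    have "norm (f k) \<le> M + norm v" for k using that[of k] norm_triangle_sub[of "f k" v] by linarith
    then show ?thesis unfolding bounded_iff by blast
  qed
  have "norm (X k 1 - p) \<le> sqrt (s 0)" for k
    using X_1[of k] Z_dist[of 1 k] N_pos by simp
  then have X_1_bounded: "bounded (range (\<lambda>k. X k 1))" by (rule bounded_shift)
  show "bounded (range (\<lambda>k. X k i))" if "i \<le> Suc N" for i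
    using that
  proof (induction i)
    case 0 then show ?case using X_1_bounded by (simp add: X_0)
  next
    case (Suc i)
    have "bounded (range (\<lambda>k. X k i + (X k (Suc i) - X k i)))"
      using Suc by (intro bounded_plus_comp convergent_imp_bounded[OF X_diff]) auto
    then show ?case by simp
  qed
  show "bounded (range (\<lambda>k. Z k i))" if i: "i \<le> Suc N" for i
  proof (cases "i \<in> {1..N}")
    case True then show ?thesis using Z_dist by (intro bounded_shift) auto
  next
    case False
    then have "i = 0 \<or> i = Suc N" using i by auto
    then show ?thesis using X_1_bounded by (auto simp: Z_0 Z_Suc)
  qed
qed

text \<open>The individual selections are only known to converge weakly, too little for a limit in
  one operator alone. Their sum and the differences of the \<open>X k i\<close> converge strongly,
  which suffices for the summed monotonicity inequality; \<open>maximally_monotone_mem_sum\<close>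
  then separates the operators.\<close>

lemma solution_of_cluster:
  assumes sol: "solution w' p'"
    and F: "F \<le> sequentially" "F \<noteq> bot"
    and c: "\<And>i u. i \<le> N \<Longrightarrow> ((\<lambda>k. Z k i \<bullet> u) \<longlongrightarrow> c i \<bullet> u) F"
  shows "solution (c(Suc N := c 0)) (c 0)"
    and "i \<le> Suc N \<Longrightarrow> ((\<lambda>k. X k i \<bullet> u) \<longlongrightarrow> c 0 \<bullet> u) F"
proof -
  \<comment> \<open>The premises say nothing about \<open>c\<close> at \<open>Suc N\<close>; the
    value is overwritten because \<open>Z k (Suc N) = Z k 0\<close>.\<close>
  define q w where "q = c 0" and "w = c(Suc N := c 0)"
  have w_ends: "w 0 = q" "w (Suc N) = q" by (simp_all add: w_def q_def)
  have Zw: "((\<lambda>k. Z k i \<bullet> u) \<longlongrightarrow> w i \<bullet> u) F" if "i \<le> Suc N" for i u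
    using that c[of i u] c[of 0 u] by (cases "i = Suc N") (auto simp: w_def Z_0 Z_Suc)
  note to_F = filterlim_mono[OF _ order_refl F(1)]
  note bd = X_bounded[OF sol] Z_bounded[OF sol]
  have X_diff_F: "((\<lambda>k. X k (Suc i) - X k i) \<longlongrightarrow> 0) F" if "i \<le> N" for i
    using X_diff[OF sol that] by (rule to_F)
  have B_F: "((\<lambda>k. B i (X k i)) \<longlongrightarrow> B i p') F" if "i \<le> N" for i
    using B_lim[OF sol that] by (rule to_F)
  have Xq: "((\<lambda>k. X k i \<bullet> u) \<longlongrightarrow> q \<bullet> u) F" if "i \<le> Suc N" for i u
    using that
  proof (induction i)
    case 0 show ?case using c[of 0 u] by (simp add: X_0 Z_0 q_def)
  next
    case (Suc i)
    have "((\<lambda>k. X k i \<bullet> u + (X k (Suc i) - X k i) \<bullet> u) \<longlongrightarrow> q \<bullet> u + 0 \<bullet> u) F"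
      using Suc by (intro tendsto_add[OF _ tendsto_inner[OF X_diff_F tendsto_const]]) auto
    then show ?case by (simp add: inner_diff_left)
  qed
  then show "i \<le> Suc N \<Longrightarrow> ((\<lambda>k. X k i \<bullet> u) \<longlongrightarrow> c 0 \<bullet> u) F" by (simp add: q_def)
  \<comment> \<open>Cocoercivity between \<open>X k i\<close> and \<open>q\<close> passes to the
    limit: the right side pairs a weakly null with a strongly convergent sequence, so
    \<open>B i q\<close> equals the strong limit \<open>B i p'\<close>.\<close>
  have Bq: "B i q = B i p'" if i: "i \<le> N" for i
  proof -
    have "((\<lambda>k. (X k i - q) \<bullet> (B i (X k i) - B i q)) \<longlongrightarrow> (q - q) \<bullet> (B i p' - B i q)) F"
    proof (rule tendsto_inner_strong_weak)
      show "((\<lambda>k. B i (X k i) - B i q) \<longlongrightarrow> B i p' - B i q) F"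
        using i by (intro tendsto_intros B_F)
      show "((\<lambda>k. (X k i - q) \<bullet> u) \<longlongrightarrow> (q - q) \<bullet> u) F" for u
        unfolding inner_diff_left using i by (intro tendsto_intros Xq) simp
      show "bounded (range (\<lambda>k. X k i - q))"
        using bd(1)[of i] i bounded_minus_comp[of "\<lambda>k. X k i" UNIV "\<lambda>_. q"] by simp
    qed
    moreover have "((\<lambda>k. (norm (B i (X k i) - B i q))\<^sup>2 / L) \<longlongrightarrow> (norm (B i p' - B i q))\<^sup>2 / L) F"
      using i L_pos by (intro tendsto_intros B_F) auto
    moreover have "(norm (B i (X k i) - B i q))\<^sup>2 / L \<le> (X k i - q) \<bullet> (B i (X k i) - B i q)" for k
      using B_coc_ineq[OF i] by (simp add: inner_commute)
    ultimately have "(norm (B i p' - B i q))\<^sup>2 / L \<le> (q - q) \<bullet> (B i p' - B i q)"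
      using tendsto_le[OF F(2)] by (metis (no_types, lifting) always_eventually)
    then have "(norm (B i p' - B i q))\<^sup>2 \<le> 0" using L_pos by (simp add: divide_le_0_iff)
    then show ?thesis by simp
  qed
  define a where "a k i = (1 / lam) *\<^sub>R (Z k (Suc i) - Z k i + X k i - X k (Suc i)) - B i (X k i)" for k i
  define \<alpha> where "\<alpha> i = (1 / lam) *\<^sub>R (w (Suc i) - w i) - B i q" for i
  have a_mem: "a k i \<in> A (Suc i) (X k (Suc i))" if "i \<le> N" for k i
    unfolding a_def using X_mem[OF that] .
  have a_bounded: "bounded (range (\<lambda>k. a k i))" if i: "i \<le> N" for i
    unfolding a_def using i convergent_imp_bounded[OF B_lim[OF sol i]]
    by (intro bounded_minus_comp bounded_plus_comp bounded_scaleR_comp bd) auto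
  have a_lim: "((\<lambda>k. a k i \<bullet> u) \<longlongrightarrow> \<alpha> i \<bullet> u) F" if i: "i \<le> N" for i u
  proof -
    have "((\<lambda>k. (1 / lam) * (Z k (Suc i) \<bullet> u - Z k i \<bullet> u + X k i \<bullet> u - X k (Suc i) \<bullet> u) - B i (X k i) \<bullet> u)
       \<longlongrightarrow> (1 / lam) * (w (Suc i) \<bullet> u - w i \<bullet> u + q \<bullet> u - q \<bullet> u) - B i p' \<bullet> u) F"
      using i by (intro tendsto_intros Zw Xq B_F) auto
    then show ?thesis
      by (simp add: a_def \<alpha>_def Bq[OF i] inner_diff_left inner_add_left inner_scaleR_left)
  qed
  have telescope: "(\<Sum>i\<le>N. f (Suc i) - f i) = f (Suc N) - f 0" for f :: "nat \<Rightarrow> 'a"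
    by (induction N) simp_all
  \<comment> \<open>The \<open>Z\<close> differences cancel since
    \<open>Z k 0 = Z k (Suc N)\<close>; what remains converges strongly.\<close>
  have sum_a: "(\<Sum>i\<le>N. a k i) = (1 / lam) *\<^sub>R (X k 0 - X k (Suc N)) - (\<Sum>i\<le>N. B i (X k i))" for k
  proof -
    have "(\<Sum>i\<le>N. Z k (Suc i) - Z k i + X k i - X k (Suc i))
        = (\<Sum>i\<le>N. Z k (Suc i) - Z k i) - (\<Sum>i\<le>N. X k (Suc i) - X k i)"
      by (simp add: sum_subtractf[symmetric] algebra_simps)
    also have "\<dots> = X k 0 - X k (Suc N)" unfolding telescope by (simp add: Z_0 Z_Suc)
    finally show ?thesis by (simp add: a_def sum_subtractf scaleR_sum_right[symmetric])
  qed
  have sum_\<alpha>: "(\<Sum>i\<le>N. \<alpha> i) = - (\<Sum>i\<le>N. B i p')"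
    unfolding \<alpha>_def sum_subtractf[where g = "\<lambda>i. B i q"] scaleR_sum_right[symmetric] telescope w_ends
    by (simp add: Bq)
  have X_diff0: "((\<lambda>k. X k i - X k 0) \<longlongrightarrow> 0) F" if "i \<le> Suc N" for i
    using that
  proof (induction i)
    case (Suc i)
    then have "((\<lambda>k. (X k (Suc i) - X k i) + (X k i - X k 0)) \<longlongrightarrow> 0 + 0) F"
      by (intro tendsto_intros X_diff_F) auto
    then show ?case by simp
  qed simp
  have sum_a_lim: "((\<lambda>k. \<Sum>i\<le>N. a k i) \<longlongrightarrow> (\<Sum>i\<le>N. \<alpha> i)) F"
  proof -
    have "((\<lambda>k. - ((1 / lam) *\<^sub>R (X k (Suc N) - X k 0)) - (\<Sum>i\<le>N. B i (X k i)))
      \<longlongrightarrow> - ((1 / lam) *\<^sub>R 0) - (\<Sum>i\<le>N. B i p')) F"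
      by (intro tendsto_intros X_diff0 B_F) auto
    then show ?thesis unfolding sum_a sum_\<alpha> by (simp add: algebra_simps)
  qed
  have "\<alpha> j \<in> A (Suc j) q" if j: "j \<in> {..N}" for j
  proof (rule maximally_monotone_mem_sum[where A = "\<lambda>i. A (Suc i)" and x = "\<lambda>_. q", OF _ _ _ j])
    fix P Q assume PQ: "\<And>i. i \<in> {..N} \<Longrightarrow> Q i \<in> A (Suc i) (P i)"
    have "0 \<le> (\<Sum>i\<le>N. (X k (Suc i) - P i) \<bullet> (a k i - Q i))" for k
      using PQ a_mem A_mono by (intro sum_nonneg) auto
    \<comment> \<open>Anchoring at \<open>X k 0\<close> leaves products of a strongly and a weakly
      convergent factor, besides terms linear in one weakly convergent sequence.\<close>
    moreover have "(\<Sum>i\<le>N. (X k (Suc i) - P i) \<bullet> (a k i - Q i))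
      = (\<Sum>i\<le>N. a k i \<bullet> (X k (Suc i) - X k 0)) + X k 0 \<bullet> (\<Sum>i\<le>N. a k i)
        - (\<Sum>i\<le>N. X k (Suc i) \<bullet> Q i) - (\<Sum>i\<le>N. a k i \<bullet> P i) + (\<Sum>i\<le>N. P i \<bullet> Q i)" for k
      unfolding inner_sum_right sum.distrib[symmetric] sum_subtractf[symmetric]
      by (intro sum.cong refl) (simp add: inner_diff_left inner_diff_right inner_commute)
    moreover have "((\<lambda>k. (\<Sum>i\<le>N. a k i \<bullet> (X k (Suc i) - X k 0)) + X k 0 \<bullet> (\<Sum>i\<le>N. a k i)
        - (\<Sum>i\<le>N. X k (Suc i) \<bullet> Q i) - (\<Sum>i\<le>N. a k i \<bullet> P i) + (\<Sum>i\<le>N. P i \<bullet> Q i))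
      \<longlongrightarrow> (\<Sum>i\<le>N. \<alpha> i \<bullet> 0) + q \<bullet> (\<Sum>i\<le>N. \<alpha> i)
        - (\<Sum>i\<le>N. q \<bullet> Q i) - (\<Sum>i\<le>N. \<alpha> i \<bullet> P i) + (\<Sum>i\<le>N. P i \<bullet> Q i)) F"
      by (intro tendsto_add tendsto_diff tendsto_sum tendsto_const
            tendsto_inner_strong_weak[OF X_diff0 a_lim a_bounded]
            tendsto_inner_strong_weak[OF sum_a_lim Xq bd(1)] Xq a_lim) auto
    ultimately have "0 \<le> (\<Sum>i\<le>N. \<alpha> i \<bullet> 0) + q \<bullet> (\<Sum>i\<le>N. \<alpha> i)
        - (\<Sum>i\<le>N. q \<bullet> Q i) - (\<Sum>i\<le>N. \<alpha> i \<bullet> P i) + (\<Sum>i\<le>N. P i \<bullet> Q i)"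
      using F(2) by (intro tendsto_lowerbound) auto
    also have "\<dots> = (\<Sum>i\<le>N. (q - P i) \<bullet> (\<alpha> i - Q i))"
      unfolding inner_sum_right sum.distrib[symmetric] sum_subtractf[symmetric]
      by (intro sum.cong refl) (simp add: inner_diff_left inner_diff_right inner_commute)
    finally show "0 \<le> (\<Sum>i\<le>N. (q - P i) \<bullet> (\<alpha> i - Q i))" .
  qed (auto intro: A_max)
  then have "solution w q" unfolding solution_def \<alpha>_def using w_ends by auto
  then show "solution (c(Suc N := c 0)) (c 0)" by (simp add: w_def q_def)
qed

section \<open>Uniqueness of the weak cluster point\<close>

lemma solution_unique_p:
  assumes "solution w p" "solution w' p'" "w 1 = w' 1"
  shows "p = p'"
proof -
  \<comment> \<open>The inclusion at index 0, where \<open>w 0 = p\<close> and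
    \<open>B 0 = 0\<close>, recovers \<open>p\<close> as the first resolvent of
    \<open>w 1\<close>.\<close>
  have "resolvent lam (A 1) (w 1) = p" if "solution w p" for w p
  proof (rule resolvent_eqI[where b = "(1 / lam) *\<^sub>R (w 1 - p)"])
    show "maximally_monotone (A 1)" using A_max[of 0] by simp
    have "(1 / lam) *\<^sub>R (w (Suc 0) - w 0) - B 0 p \<in> A (Suc 0) p" "w 0 = p"
      using that unfolding solution_def by blast+
    then show "(1 / lam) *\<^sub>R (w 1 - p) \<in> A 1 p" by (simp add: B_0)
  qed (use lam_pos in auto)
  then show ?thesis using assms by metis
qed

text \<open>Opial's argument: the distances to both cluster points converge, hence so does the inner
  product of \<open>Z k\<close> with their difference.\<close>

lemma cluster_unique:
  assumes sol: "solution w p" "solution w' p'"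
    and F: "F \<le> sequentially" "F \<noteq> bot" "\<And>i u. i \<in> {1..N} \<Longrightarrow> ((\<lambda>k. Z k i \<bullet> u) \<longlongrightarrow> w i \<bullet> u) F"
    and F': "F' \<le> sequentially" "F' \<noteq> bot" "\<And>i u. i \<in> {1..N} \<Longrightarrow> ((\<lambda>k. Z k i \<bullet> u) \<longlongrightarrow> w' i \<bullet> u) F'"
    and i: "i \<in> {1..N}"
  shows "w i = w' i"
proof -
  obtain l l' where l: "(\<lambda>k. \<Sum>i=1..N. (norm (Z k i - w i))\<^sup>2) \<longlonglongrightarrow> l"
    "(\<lambda>k. \<Sum>i=1..N. (norm (Z k i - w' i))\<^sup>2) \<longlonglongrightarrow> l'"
    using Z_dist_convergent sol unfolding convergent_def by blast
  \<comment> \<open>In the difference of the two squared distances the quadratic terms in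
    \<open>Z k\<close> cancel; \<open>K\<close> collects the constants and \<open>m\<close> is the
    resulting limit of the pairing.\<close>
  define K where "K = (\<Sum>i=1..N. (norm (w i))\<^sup>2 - (norm (w' i))\<^sup>2)"
  define m where "m = (K - (l - l')) / 2"
  have "(\<Sum>i=1..N. Z k i \<bullet> (w i - w' i))
      = (K - ((\<Sum>i=1..N. (norm (Z k i - w i))\<^sup>2) - (\<Sum>i=1..N. (norm (Z k i - w' i))\<^sup>2))) / 2" for k
    unfolding K_def sum_subtractf[symmetric] sum_divide_distrib
    by (intro sum.cong refl) (simp add: power2_norm_eq_inner inner_diff inner_commute field_simps)
  then have lim: "(\<lambda>k. \<Sum>i=1..N. Z k i \<bullet> (w i - w' i)) \<longlonglongrightarrow> m"
    unfolding m_def by (simp only:) (intro tendsto_intros l, simp)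
  have "(\<Sum>i=1..N. w i \<bullet> (w i - w' i)) = m"
    by (rule tendsto_unique[OF F(2) _ filterlim_mono[OF lim order_refl F(1)]])
       (intro tendsto_sum F(3))
  moreover have "(\<Sum>i=1..N. w' i \<bullet> (w i - w' i)) = m"
    by (rule tendsto_unique[OF F'(2) _ filterlim_mono[OF lim order_refl F'(1)]])
       (intro tendsto_sum F'(3))
  ultimately have "(\<Sum>i=1..N. (w i - w' i) \<bullet> (w i - w' i)) = 0"
    by (simp only: inner_diff_left sum_subtractf)
  then have "(w i - w' i) \<bullet> (w i - w' i) = 0"
    using i by (subst (asm) sum_nonneg_eq_0_iff) auto
  then show ?thesis by simp
qed

text \<open>One cluster filter fixes a candidate. Every other cluster point agrees with it, by
  \<open>cluster_unique\<close> at the indices from 1 to \<open>N\<close> and by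
  \<open>solution_unique_p\<close> at 0, so the whole sequence converges.\<close>

lemma weak_convergence:
  assumes "solution w0 p0"
  obtains w p where "solution w p"
    "\<And>i u. i \<in> {1..N} \<Longrightarrow> (\<lambda>k. Z k i \<bullet> u) \<longlonglongrightarrow> w i \<bullet> u"
    "\<And>i u. i \<le> Suc N \<Longrightarrow> (\<lambda>k. X k i \<bullet> u) \<longlonglongrightarrow> p \<bullet> u"
    "\<And>i. i \<le> N \<Longrightarrow> (\<lambda>k. B i (X k i)) \<longlonglongrightarrow> B i p"
proof -
  \<comment> \<open>Zero beyond \<open>N\<close>, so that every member of the family is bounded, as
    \<open>weak_cluster_filter\<close> demands.\<close>
  define v where "v i k = (if i \<le> N then Z k i else 0)" for i k
  have bd: "bounded (range (v i))" for i
    using Z_bounded[OF assms, of i] by (cases "i \<le> N") (simp_all add: v_def[abs_def])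
  have cluster: "solution (c(Suc N := c 0)) (c 0)" "((\<lambda>k. Z k i \<bullet> u) \<longlongrightarrow> (c(Suc N := c 0)) i \<bullet> u) F"
    if "F \<le> sequentially" "F \<noteq> bot" "\<And>i u. ((\<lambda>k. v i k \<bullet> u) \<longlongrightarrow> c i \<bullet> u) F" "i \<in> {1..N}" for F c i u
  proof -
    have "((\<lambda>k. Z k i \<bullet> u) \<longlongrightarrow> c i \<bullet> u) F" if "i \<le> N" for i u
      using that \<open>\<And>i u. ((\<lambda>k. v i k \<bullet> u) \<longlongrightarrow> c i \<bullet> u) F\<close>[of i u] by (simp add: v_def)
    with that solution_of_cluster[OF assms that(1,2), of c]
    show "solution (c(Suc N := c 0)) (c 0)" "((\<lambda>k. Z k i \<bullet> u) \<longlongrightarrow> (c(Suc N := c 0)) i \<bullet> u) F"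
      by auto
  qed
  have one: "1 \<in> {1..N}" using N_pos by simp
  obtain F0 c0 where F0: "F0 \<le> sequentially" "F0 \<noteq> bot"
    and c0: "\<And>i u. ((\<lambda>k. v i k \<bullet> u) \<longlongrightarrow> c0 i \<bullet> u) F0"
    using weak_cluster_filter[of sequentially v] bd by (metis sequentially_bot)
  define w p where "w = c0(Suc N := c0 0)" and "p = c0 0"
  have sol: "solution w p" unfolding w_def p_def using cluster(1)[OF F0 c0 one] .
  have Z_F0: "((\<lambda>k. Z k i \<bullet> u) \<longlongrightarrow> w i \<bullet> u) F0" if "i \<in> {1..N}" for i u
    unfolding w_def using cluster(2)[OF F0 c0 that] .
  have eq: "c j = w j" if F: "F \<le> sequentially" "F \<noteq> bot" "\<And>i u. ((\<lambda>k. v i k \<bullet> u) \<longlongrightarrow> c i \<bullet> u) F"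
    and j: "j \<le> N" for F c j
  proof -
    let ?w' = "c(Suc N := c 0)"
    have sol': "solution ?w' (c 0)" using cluster(1)[OF F one] .
    have w'_eq: "w i = ?w' i" if "i \<in> {1..N}" for i
      using cluster_unique[OF sol sol' F0 Z_F0 F(1,2) cluster(2)[OF F] that] .
    show ?thesis
    proof (cases "j = 0")
      case True
      have "p = c 0" using solution_unique_p[OF sol sol' w'_eq[OF one]] .
      then show ?thesis using True by (simp add: w_def p_def)
    next
      case False
      then show ?thesis using w'_eq[of j] j by simp
    qed
  qed
  have Z_lim: "(\<lambda>k. Z k j \<bullet> u) \<longlonglongrightarrow> w j \<bullet> u" if "j \<le> N" for j u
  proof -
    have "(\<lambda>k. v j k \<bullet> u) \<longlonglongrightarrow> w j \<bullet> u"
      by (rule weak_limit_of_unique_cluster[OF bd]) (rule eq[OF _ _ _ that])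
    then show ?thesis using that by (simp add: v_def)
  qed
  show thesis
  proof (rule that[OF sol])
    show "(\<lambda>k. Z k i \<bullet> u) \<longlonglongrightarrow> w i \<bullet> u" if "i \<in> {1..N}" for i u using Z_lim that by simp
    \<comment> \<open>Here \<open>sequentially\<close> itself serves as the filter in
      \<open>solution_of_cluster\<close>.\<close>
    show "(\<lambda>k. X k i \<bullet> u) \<longlonglongrightarrow> p \<bullet> u" if "i \<le> Suc N" for i u
      using solution_of_cluster(2)[OF assms order_refl _ Z_lim that] sol by (simp add: solution_def)
    show "(\<lambda>k. B i (X k i)) \<longlonglongrightarrow> B i p" if "i \<le> N" for i using B_lim[OF sol that] .
  qed
qed

end

section \<open>Convergence of the method\<close>

lemma zer_sum_iff:
  "p \<in> zer (\<lambda>p. (\<Sum>i=1..m. A i p) + (\<Sum>i=1..n. {B i p})) \<longleftrightarrow>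
    (\<exists>a. (\<forall>i\<in>{1..m}. a i \<in> A i p) \<and> (\<Sum>i=1..m. a i) + (\<Sum>i=1..n. B i p) = 0)"
  for A :: "nat \<Rightarrow> 'a \<Rightarrow> 'b::comm_monoid_add set" and m n :: nat
proof -
  have "(\<Sum>i=1..n. {B i p}) = {\<Sum>i=1..n. B i p}"
    unfolding set_sum_alt[OF finite_atLeastAtMost] by (auto intro!: exI[of _ "\<lambda>i. B i p"])
  then show ?thesis
    unfolding zer_def set_sum_alt[OF finite_atLeastAtMost] by (auto simp: set_plus_def)
qed

context ring_splitting
begin

text \<open>Fed from a solution, every resolvent around the ring returns \<open>p\<close>, so
  solutions yield fixed points of \<open>T\<close>. The map \<open>B'\<close> may differ from
  \<open>B\<close> at 0, where the locale prescribes the zero map.\<close>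

lemma sweep_solution:
  assumes sol: "solution w p" and z: "\<And>i. i \<in> {1..N} \<Longrightarrow> z i = w i"
    and B': "\<And>i. i \<in> {1..N} \<Longrightarrow> B' i = B i" and i: "i \<in> {1..Suc N}"
  shows "sweep (Suc N) lam A B' z i = p"
  using i
proof (induction i rule: less_induct)
  case (less i)
  have res: "resolvent lam (A (Suc j)) y = p"
    if "j \<le> N" "y = p + w (Suc j) - w j - lam *\<^sub>R B j p" for j y
    using sol that lam_pos
    by (intro resolvent_eqI[OF A_max, where b = "(1 / lam) *\<^sub>R (w (Suc j) - w j) - B j p"])
       (auto simp: solution_def algebra_simps)
  consider "i = 1" | j where "i = Suc (Suc j)"
    using less.prems by (metis One_nat_def Suc_le_D atLeastAtMost_iff not0_implies_Suc)
  then show ?case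
  proof cases
    case 1
    then show ?thesis
      using res[of 0] sol z[of 1] N_pos by (simp add: solution_def B_0)
  next
    case 2
    \<comment> \<open>At the last index \<open>sweep\<close> uses its first component in place of
      \<open>z\<close>, matching the closing condition \<open>w (Suc N) = p\<close>.\<close>
    have w: "(if j + 2 < Suc N then z (j + 2) else sweep (Suc N) lam A B' z 1) = w (j + 2)"
    proof (cases "j + 2 < Suc N")
      case True then show ?thesis using z[of "j + 2"] by simp
    next
      case False
      then have "j + 2 = Suc N" using 2 less.prems by simp
      moreover have "sweep (Suc N) lam A B' z 1 = p" using less.IH[of 1] 2 by simp
      ultimately show ?thesis using sol by (simp add: solution_def)
    qed
    have prev: "sweep (Suc N) lam A B' z (j + 1) = p" using less.IH[of "j + 1"] less.prems 2 by simp
    have mem: "j + 1 \<in> {1..N}" using 2 less.prems by simp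
    show ?thesis
      unfolding 2 sweep.simps(3) w prev z[OF mem] B'[OF mem]
      using res[of "j + 1"] mem by (simp add: algebra_simps)
  qed
qed

end

theorem theorem3p7:
  fixes A :: "nat \<Rightarrow> 'a::{real_inner, complete_space} \<Rightarrow> 'a set"
    and B :: "nat \<Rightarrow> 'a \<Rightarrow> 'a"
    and n :: nat
    and L lam \<gamma> :: real
    and z0 :: "nat \<Rightarrow> 'a"
    and z x :: "nat \<Rightarrow> nat \<Rightarrow> 'a"
  assumes "n \<ge> 2" and "L > 0"
    and "\<And>i. i \<in> {1..n} \<Longrightarrow> maximally_monotone (A i)"
    and "\<And>i. i \<in> {1..n - 1} \<Longrightarrow> cocoercive (1 / L) (B i)"
    and "zer (\<lambda>p. (\<Sum>i=1..n. A i p) + (\<Sum>i=1..n - 1. {B i p})) \<noteq> {}"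
    and "lam \<in> {0<..<2 / L}"
    and "\<gamma> \<in> {0<..<1 - lam * L / 2}"
    and "z0 \<in> hpow (n - 1)" and "z 0 = z0"
    and "\<And>k. z k \<in> hpow (n - 1)"
    and "\<And>k. x k \<in> hpow n"
    and "\<And>k. x k 1 = resolvent lam (A 1) (z k 1)"
    and "\<And>k i. i \<in> {2..n - 1} \<Longrightarrow>
      x k i = resolvent lam (A i)
        (z k i + x k (i - 1) - z k (i - 1) - lam *\<^sub>R B (i - 1) (x k (i - 1)))"
    and "\<And>k. x k n = resolvent lam (A n)
        (x k 1 + x k (n - 1) - z k (n - 1) - lam *\<^sub>R B (n - 1) (x k (n - 1)))"
    and "\<And>k i. i \<in> {1..n - 1} \<Longrightarrow>
      z (Suc k) i = z k i + \<gamma> *\<^sub>R (x k (i + 1) - x k i)"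
  shows "(\<exists>zlim \<in> Fix_on (hpow (n - 1)) (T_op n lam \<gamma> A B). weakly_converges (n - 1) z zlim)
    \<and> (\<exists>xlim \<in> zer (\<lambda>p. (\<Sum>i=1..n. A i p) + (\<Sum>i=1..n - 1. {B i p})).
          weakly_converges n x (\<lambda>i\<in>{1..n}. xlim)
        \<and> (\<forall>i\<in>{1..n - 1}. (\<lambda>k. B i (x k i)) \<longlonglongrightarrow> B i xlim))"
proof -
  define N where "N = n - 1"
  have n: "n = Suc N" and N: "N \<ge> 1" "n - 1 = N" using \<open>n \<ge> 2\<close> by (auto simp: N_def)
  define Z where "Z k i = (if i = 0 \<or> i = Suc N then x k 1 else z k i)" for k i
  define X where "X k i = (if i = 0 then x k 1 else x k i)" for k i
  \<comment> \<open>The zero map at index 0 gives the first resolvent step the shape of the others;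
    the hypotheses say nothing about \<open>B 0\<close>.\<close>
  define B' where "B' = B(0 := \<lambda>_. 0)"
  have B': "B' i = B i" if "i \<in> {1..N}" for i using that by (simp add: B'_def)
  have lam: "lam > 0" using assms(6) by simp
  interpret ring_splitting A B' N L lam \<gamma> Z X
  proof
    show "L > 0" "lam > 0" "\<gamma> > 0" "\<gamma> < 1 - lam * L / 2" "N \<ge> 1" using assms(2,6,7) N by auto
    show A: "maximally_monotone (A (Suc i))" if "i \<le> N" for i using assms(3) that n by simp
    show "cocoercive (1 / L) (B' i)" if "i \<le> N" for i
      using assms(4)[of i] that N by (cases "i = 0") (simp_all add: B'_def cocoercive_def)
    show "B' 0 = (\<lambda>_. 0)" by (simp add: B'_def)
    show "X k 0 = X k 1" "Z k 0 = X k 1" "Z k (Suc N) = X k 1" for k by (simp_all add: X_def Z_def)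
    show "Z (Suc k) i = Z k i + \<gamma> *\<^sub>R (X k (Suc i) - X k i)" if "i \<in> {1..N}" for k i
      using assms(15)[of i k] that N by (simp add: Z_def X_def)
    show "(1 / lam) *\<^sub>R (Z k (Suc i) - Z k i + X k i - X k (Suc i)) - B' i (X k i)
        \<in> A (Suc i) (X k (Suc i))" if i: "i \<le> N" for k i
    proof -
      \<comment> \<open>The common form of all resolvent arguments: for \<open>i = 0\<close> the
        terms \<open>X k 0\<close> and \<open>Z k 0\<close> cancel, for \<open>i = N\<close> the
        entry \<open>Z k (Suc i)\<close> is \<open>x k 1\<close>.\<close>
      define y where "y = Z k (Suc i) + X k i - Z k i - lam *\<^sub>R B' i (X k i)"
      have "X k (Suc i) = resolvent lam (A (Suc i)) y"
      proof (cases "i = 0")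
        case True
        then show ?thesis using assms(12)[of k] N by (simp add: y_def X_def Z_def B'_def)
      next
        case False
        show ?thesis
        proof (cases "i = N")
          case True
          then show ?thesis using assms(14)[of k] False n by (simp add: y_def X_def Z_def B'_def)
        next
          case F: False
          then have "Suc i \<in> {2..n - 1}" using i False n by simp
          then show ?thesis using assms(13)[of "Suc i" k] False F i by (simp add: y_def X_def Z_def B'_def)
        qed
      qed
      moreover have "(1 / lam) *\<^sub>R (Z k (Suc i) - Z k i + X k i - X k (Suc i)) - B' i (X k i)
          = (1 / lam) *\<^sub>R (y - X k (Suc i))"
        using lam by (simp add: y_def algebra_simps)
      ultimately show ?thesis using resolvent_mem[OF A[OF i] lam, of y] by simp
    qed
  qed
  have zer_iff: "p \<in> zer (\<lambda>p. (\<Sum>i=1..n. A i p) + (\<Sum>i=1..n - 1. {B i p})) \<longleftrightarrow> (\<exists>w. solution w p)"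
    for p
  proof -
    have Bs: "(\<Sum>i=1..n - 1. B i p) = (\<Sum>i\<le>N. B' i p)"
      unfolding N(2) by (subst sum_atMost_drop_zero) (simp_all add: B'_def)
    have As: "(\<Sum>i=1..n. a i) = (\<Sum>i\<le>N. a (Suc i))" for a :: "nat \<Rightarrow> 'a"
      unfolding n by (simp only: One_nat_def sum.atLeast1_atMost_eq lessThan_Suc_atMost)
    \<comment> \<open>Selections are numbered from 1 in the theorem but from 0 in the ring.\<close>
    have reindex: "(\<exists>a. (\<forall>i\<in>{1..n}. a i \<in> A i p) \<and> (\<Sum>i\<le>N. a (Suc i)) + b = 0)
      \<longleftrightarrow> (\<exists>a. (\<forall>i\<le>N. a i \<in> A (Suc i) p) \<and> (\<Sum>i\<le>N. a i) + b = 0)" for b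
    proof
      assume "\<exists>a. (\<forall>i\<in>{1..n}. a i \<in> A i p) \<and> (\<Sum>i\<le>N. a (Suc i)) + b = 0"
      then obtain a where "\<forall>i\<in>{1..n}. a i \<in> A i p" "(\<Sum>i\<le>N. a (Suc i)) + b = 0" by blast
      then show "\<exists>a. (\<forall>i\<le>N. a i \<in> A (Suc i) p) \<and> (\<Sum>i\<le>N. a i) + b = 0"
        using n by (intro exI[of _ "\<lambda>i. a (Suc i)"]) auto
    next
      assume "\<exists>a. (\<forall>i\<le>N. a i \<in> A (Suc i) p) \<and> (\<Sum>i\<le>N. a i) + b = 0"
      then obtain a where a: "\<forall>i\<le>N. a i \<in> A (Suc i) p" "(\<Sum>i\<le>N. a i) + b = 0" by blast
      have "a (i - 1) \<in> A i p" if "i \<in> {1..n}" for i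
        using a(1)[rule_format, of "i - 1"] that n by auto
      then show "\<exists>a. (\<forall>i\<in>{1..n}. a i \<in> A i p) \<and> (\<Sum>i\<le>N. a (Suc i)) + b = 0"
        using a(2) by (intro exI[of _ "\<lambda>i. a (i - 1)"]) auto
    qed
    show ?thesis
      unfolding zer_sum_iff solution_iff_sum_zero Bs As reindex sum.distrib ..
  qed
  obtain w0 p0 where "solution w0 p0" using assms(5) zer_iff by blast
  then obtain w p where sol: "solution w p"
    and Z_lim: "\<And>i u. i \<in> {1..N} \<Longrightarrow> (\<lambda>k. Z k i \<bullet> u) \<longlonglongrightarrow> w i \<bullet> u"
    and X_lim: "\<And>i u. i \<le> Suc N \<Longrightarrow> (\<lambda>k. X k i \<bullet> u) \<longlonglongrightarrow> p \<bullet> u"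
    and B_lim: "\<And>i. i \<le> N \<Longrightarrow> (\<lambda>k. B' i (X k i)) \<longlonglongrightarrow> B' i p"
    by (rule weak_convergence) blast
  \<comment> \<open>Since \<open>w\<close> also carries the ring entries at 0 and
    \<open>Suc N\<close>, restriction is what makes it a tuple in
    \<open>hpow (n - 1)\<close>.\<close>
  define zlim where "zlim = restrict w {1..N}"
  have sweep: "sweep n lam A B zlim i = p" if "i \<in> {1..n}" for i
    using sweep_solution[OF sol, of zlim B i] B' that n by (simp add: zlim_def)
  have "T_op n lam \<gamma> A B zlim = zlim"
  proof
    fix i
    show "T_op n lam \<gamma> A B zlim i = zlim i"
    proof (cases "i \<in> {1..N}")
      case True
      then have "i + 1 \<in> {1..n}" "i \<in> {1..n}" using n by auto
      note this[THEN sweep]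
      then show ?thesis using True unfolding T_op_def N(2) by simp
    next
      case False
      then show ?thesis unfolding T_op_def N(2) zlim_def by (simp only: restrict_apply if_False)
    qed
  qed
  moreover have "zlim \<in> hpow (n - 1)" by (simp only: N(2) hpow_def zlim_def restrict_extensional)
  moreover have "weakly_converges (n - 1) z zlim"
    unfolding weakly_converges_def hinner_def N(2)
  proof (intro ballI tendsto_sum)
    fix u :: "nat \<Rightarrow> 'a" and i assume i: "i \<in> {1..N}"
    then show "(\<lambda>k. z k i \<bullet> u i) \<longlonglongrightarrow> zlim i \<bullet> u i"
      using Z_lim[OF i, of "u i"] by (simp add: Z_def zlim_def)
  qed
  moreover have "weakly_converges n x (\<lambda>i\<in>{1..n}. p)"
    unfolding weakly_converges_def hinner_def
  proof (intro ballI tendsto_sum)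
    fix u :: "nat \<Rightarrow> 'a" and i assume i: "i \<in> {1..n}"
    then show "(\<lambda>k. x k i \<bullet> u i) \<longlonglongrightarrow> (\<lambda>i\<in>{1..n}. p) i \<bullet> u i"
      using X_lim[of i "u i"] n by (simp add: X_def)
  qed
  moreover have "\<forall>i\<in>{1..n - 1}. (\<lambda>k. B i (x k i)) \<longlonglongrightarrow> B i p"
  proof
    fix i assume "i \<in> {1..n - 1}"
    then show "(\<lambda>k. B i (x k i)) \<longlonglongrightarrow> B i p"
      using B_lim[of i] N by (simp add: X_def B'_def)
  qed
  moreover have "p \<in> zer (\<lambda>p. (\<Sum>i=1..n. A i p) + (\<Sum>i=1..n - 1. {B i p}))"
    using zer_iff sol by blast
  ultimately show ?thesis unfolding Fix_on_def by blast
qed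

end
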